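(* Let $f:\mathbb{R}\to\mathbb{R}$ be $L$-Lipschitz smooth, $\mu$-strongly convex and bounded from below, and let $\gamma\ge 1/2$. Let $b_n,c_n\in\mathbb{R}^n$ ($n\in\mathbb{N}$) satisfy $\|b_n\|_\infty,\|b_n\|_1,\|c_n\|_\infty,\|c_n\|_1=\Theta(1)$; let $s_n\in(0,\infty)^n$ satisfy $\|1/s_n\|_\infty\le O(n^\gamma)$ and $\|1/s_n\|_2=\Theta(n)$, where $1/s_n$ is the entrywise reciprocal; and let $R_n,Q_n\in\mathbb{R}^{n\times n}$ be drawn independently from the Haar measure over orthogonal matrices. Set $A_n=R_n\,\mathrm{diag}(s_n)\,Q_n^{\mathrm T}$ and $B_n=I_n$, and consider the family of physical design problems $\{(f,c_n,\varphi_n\equiv(A_n,B_n,b_n)):n\in\mathbb{N}\}$. Then: (a) $\|A_n^{-1}\|_2\le O(n^\gamma)$; (b) $\mathrm{E}\big(\|B_n^{\mathrm T}(A_n^{-1}b_n\odot A_n^{-\mathrm T}c_n)\|_2^2\big)\ge\Omega(n)$; (c) $\mathrm{E}\big(|c_n^{\mathrm T}A_n^{-1}b_n|^2\big)\le O(1)$. Consequently this family on average satisfies the $(1-\gamma,\gamma)$-asymptotic convergence conditions, i.e. conditions (A)–(E) of that definition (see context) hold, while (F), (G) with $\alpha=1-\gamma$ hold in the averaged sense of (b), (c) respectively.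
   Context: $\|v\|_p$ is the $l^p$ norm of a vector; $\|M\|_p$ is the induced $l^p$ operator norm of a matrix; $\odot$ is the elementwise product of vectors; $I_n$ is the identity matrix. Asymptotics are as $n\to\infty$: $a_n\le O(g(n))$ (resp. $a_n\ge\Omega(g(n))$) means there is $C>0$ with $a_n\le Cg(n)$ (resp. $a_n\ge Cg(n)$) for all large $n$; $\Theta$ means both. $f$ is $L$-Lipschitz smooth if it is differentiable and $|f'(x)-f'(y)|\le L|x-y|$; $\mu$-strongly convex ($\mu>0$) if $f(y)\ge f(x)+f'(x)(y-x)+\frac{\mu}{2}|x-y|^2$. A physical system $\varphi\equiv(A,B,b)$ of state size $n$ and parameter size $m$ ($A\in\mathbb{R}^{n\times n}$, $B\in\mathbb{R}^{n\times m}$, $b\in\mathbb{R}^n$) is the map $\varphi(\theta)=(A+\mathrm{diag}(B\theta))^{-1}b$ on $\{\theta\in\mathbb{R}^m:A+\mathrm{diag}(B\theta)\text{ invertible}\}$. A physical design problem $(f,c,\varphi)$ is the minimization of $f(c^{\mathrm T}\varphi(\theta))$ over this domain; a family of physical design problems is a sequence of problems $(f,c_n,\varphi_n)$ of state size $n$ with $f$ independent of $n$. $(\alpha,\gamma)$-asymptotic convergence conditions: (A) $f$ is $L$-Lipschitz smooth, $\mu$-strongly convex and bounded from below; (B) $\|A_n^{-1}\|_2\le O(n^\gamma)$; (C) $\|B_n\|_\infty,\|B_n\|_1,\|B_n\|_2\le O(1)$; (D) $\|b_n\|_\infty,\|b_n\|_1\le O(1)$; (E) $\|c_n\|_\infty,\|c_n\|_1\le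 O(1)$; (F) $\|B_n^{\mathrm T}(A_n^{-1}b_n\odot A_n^{-\mathrm T}c_n)\|_2^2\ge\Omega(n^{\alpha+\gamma})$; (G) $|c_n^{\mathrm T}A_n^{-1}b_n|\le O(1)$. *)

theory Defs
  imports
    "HOL-Probability.Probability"
    "HOL-Library.Landau_Symbols"
    "Jordan_Normal_Form.Matrix"
    "Jordan_Normal_Form.Gauss_Jordan_Elimination"
begin

(* HOL-Analysis uses the same symbols for its type-indexed vectors and for real inner products. *)
no_notation vec_nth (infixl \<open>$\<close> 90)
no_notation inner (infix \<open>\<bullet>\<close> 70)
hide_const (open) Finite_Cartesian_Product.vec Finite_Cartesian_Product.mat
hide_type (open) Finite_Cartesian_Product.vec

section \<open>Vectors and matrices of varying size\<close>

(* Intended for 1 <= p <= infinity.  The inserted 0 only matters for the empty vector. *)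
definition lp_norm :: "ereal \<Rightarrow> real Matrix.vec \<Rightarrow> real" where
  "lp_norm p v =
     (if p = \<infinity> then Max (insert 0 ((\<lambda>i. \<bar>v $ i\<bar>) ` {..<dim_vec v}))
      else (\<Sum>i<dim_vec v. \<bar>v $ i\<bar> powr real_of_ereal p) powr (1 / real_of_ereal p))"

definition op_norm :: "ereal \<Rightarrow> real Matrix.mat \<Rightarrow> real" where
  "op_norm p M = (SUP x \<in> {x \<in> carrier_vec (dim_col M). lp_norm p x \<le> 1}. lp_norm p (M *\<^sub>v x))"

definition hprod :: "real Matrix.vec \<Rightarrow> real Matrix.vec \<Rightarrow> real Matrix.vec" (infixl \<open>\<odot>\<close> 70) where
  "v \<odot> w = Matrix.vec (dim_vec v) (\<lambda>i. v $ i * w $ i)"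

definition diag :: "real Matrix.vec \<Rightarrow> real Matrix.mat" where
  "diag v = mat_diag (dim_vec v) (\<lambda>i. v $ i)"

(* Meaningful only for invertible matrices; statements using it carry invertible_mat explicitly. *)
definition minv :: "real Matrix.mat \<Rightarrow> real Matrix.mat" where
  "minv A = the (mat_inverse A)"

section \<open>Haar measure on the orthogonal group\<close>

definition orthogonal_mats :: "nat \<Rightarrow> real Matrix.mat set" where
  "orthogonal_mats n = {Q \<in> carrier_mat n n. Q\<^sup>T * Q = 1\<^sub>m n}"

(* The Borel sets of O(n) as a subspace of the n*n-dimensional space of entries. *)
definition borel_orthogonal :: "nat \<Rightarrow> real Matrix.mat measure" where
  "borel_orthogonal n =
     vimage_algebra (orthogonal_mats n)
       (\<lambda>Q. \<lambda>ij \<in> {..<n} \<times> {..<n}. Q $$ ij)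
       (PiM ({..<n} \<times> {..<n}) (\<lambda>_. borel))"

(* Left-invariant Borel probability measure; O(n) is compact, so there is exactly one. *)
definition is_haar_orthogonal :: "nat \<Rightarrow> real Matrix.mat measure \<Rightarrow> bool" where
  "is_haar_orthogonal n \<nu> \<longleftrightarrow>
     prob_space \<nu> \<and> sets \<nu> = sets (borel_orthogonal n) \<and>
     (\<forall>U \<in> orthogonal_mats n. distr \<nu> (borel_orthogonal n) (\<lambda>Q. U * Q) = \<nu>)"

section \<open>Physical design problems\<close>

type_synonym physical_system = "real Matrix.mat \<times> real Matrix.mat \<times> real Matrix.vec"

definition is_physical_system :: "nat \<Rightarrow> nat \<Rightarrow> physical_system \<Rightarrow> bool" where
  "is_physical_system n m = (\<lambda>(A, B, b).
     A \<in> carrier_mat n n \<and> B \<in> carrier_mat n m \<and> b \<in> carrier_vec n)"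

definition system_domain :: "physical_system \<Rightarrow> real Matrix.vec set" where
  "system_domain = (\<lambda>(A, B, b). {\<theta> \<in> carrier_vec (dim_col B). invertible_mat (A + diag (B *\<^sub>v \<theta>))})"

definition system_map :: "physical_system \<Rightarrow> real Matrix.vec \<Rightarrow> real Matrix.vec" where
  "system_map = (\<lambda>(A, B, b) \<theta>. minv (A + diag (B *\<^sub>v \<theta>)) *\<^sub>v b)"

(* The design problem (f, c, \<phi>) is the minimization of this function over system_domain \<phi>. *)
definition design_objective ::
  "(real \<Rightarrow> real) \<Rightarrow> real Matrix.vec \<Rightarrow> physical_system \<Rightarrow> real Matrix.vec \<Rightarrow> real" where
  "design_objective f c \<phi> \<theta> = f (c \<bullet> system_map \<phi> \<theta>)"

(* The loss f is common to all members, so it does not occur in the size constraints. *)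
definition is_design_family ::
  "(nat \<Rightarrow> real Matrix.vec) \<Rightarrow> (nat \<Rightarrow> physical_system) \<Rightarrow> bool" where
  "is_design_family c \<phi> \<longleftrightarrow>
     (\<forall>n\<ge>1. c n \<in> carrier_vec n \<and> (\<exists>m. is_physical_system n m (\<phi> n)))"

section \<open>Asymptotic convergence conditions\<close>

definition lipschitz_smooth :: "real \<Rightarrow> (real \<Rightarrow> real) \<Rightarrow> bool" where
  "lipschitz_smooth L f \<longleftrightarrow>
     (\<forall>x. f differentiable (at x)) \<and> (\<forall>x y. \<bar>deriv f x - deriv f y\<bar> \<le> L * \<bar>x - y\<bar>)"

definition strongly_convex :: "real \<Rightarrow> (real \<Rightarrow> real) \<Rightarrow> bool" where
  "strongly_convex \<mu> f \<longleftrightarrow>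
     \<mu> > 0 \<and> (\<forall>x. f differentiable (at x)) \<and>
     (\<forall>x y. f y \<ge> f x + deriv f x * (y - x) + \<mu> / 2 * \<bar>x - y\<bar>\<^sup>2)"

definition cond_A :: "real \<Rightarrow> real \<Rightarrow> (real \<Rightarrow> real) \<Rightarrow> bool" where
  "cond_A L \<mu> f \<longleftrightarrow> lipschitz_smooth L f \<and> strongly_convex \<mu> f \<and> bdd_below (range f)"

definition cond_B :: "real \<Rightarrow> (nat \<Rightarrow> real Matrix.mat) \<Rightarrow> bool" where
  "cond_B \<gamma> A \<longleftrightarrow>
     (\<forall>n\<ge>1. invertible_mat (A n)) \<and>
     (\<lambda>n. op_norm 2 (minv (A n))) \<in> O(\<lambda>n. real n powr \<gamma>)"

definition cond_C :: "(nat \<Rightarrow> real Matrix.mat) \<Rightarrow> bool" where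
  "cond_C B \<longleftrightarrow> (\<forall>p \<in> {\<infinity>, 1, 2}. (\<lambda>n. op_norm p (B n)) \<in> O(\<lambda>_. 1))"

(* Conditions (D) and (E) are the same bound, for b and for c. *)
definition cond_DE :: "(nat \<Rightarrow> real Matrix.vec) \<Rightarrow> bool" where
  "cond_DE v \<longleftrightarrow> (\<forall>p \<in> {\<infinity>, 1}. (\<lambda>n. lp_norm p (v n)) \<in> O(\<lambda>_. 1))"

definition sensitivity :: "real Matrix.vec \<Rightarrow> physical_system \<Rightarrow> real" where
  "sensitivity c = (\<lambda>(A, B, b).
     (lp_norm 2 (B\<^sup>T *\<^sub>v ((minv A *\<^sub>v b) \<odot> ((minv A)\<^sup>T *\<^sub>v c))))\<^sup>2)"

definition response :: "real Matrix.vec \<Rightarrow> physical_system \<Rightarrow> real" where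
  "response c = (\<lambda>(A, B, b). c \<bullet> (minv A *\<^sub>v b))"

definition conditions_A_to_E ::
  "real \<Rightarrow> real \<Rightarrow> real \<Rightarrow> (real \<Rightarrow> real) \<Rightarrow> (nat \<Rightarrow> real Matrix.vec) \<Rightarrow> (nat \<Rightarrow> physical_system) \<Rightarrow> bool"
where
  "conditions_A_to_E L \<mu> \<gamma> f c \<phi> \<longleftrightarrow>
     is_design_family c \<phi> \<and> cond_A L \<mu> f \<and> cond_B \<gamma> (\<lambda>n. fst (\<phi> n)) \<and>
     cond_C (\<lambda>n. fst (snd (\<phi> n))) \<and> cond_DE (\<lambda>n. snd (snd (\<phi> n))) \<and> cond_DE c"

definition asymptotic_convergence_conditions ::
  "real \<Rightarrow> real \<Rightarrow> real \<Rightarrow> real \<Rightarrow> (real \<Rightarrow> real) \<Rightarrow> (nat \<Rightarrow> real Matrix.vec) \<Rightarrow> (nat \<Rightarrow> physical_system) \<Rightarrow> bool"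
where
  "asymptotic_convergence_conditions L \<mu> \<alpha> \<gamma> f c \<phi> \<longleftrightarrow>
     conditions_A_to_E L \<mu> \<gamma> f c \<phi> \<and>
     (\<lambda>n. sensitivity (c n) (\<phi> n)) \<in> \<Omega>(\<lambda>n. real n powr (\<alpha> + \<gamma>)) \<and>
     (\<lambda>n. \<bar>response (c n) (\<phi> n)\<bar>) \<in> O(\<lambda>_. 1)"

(* For a random family: (A)-(E) hold for every outcome; (F) holds for the mean of the sensitivity,
   and (G) for the second moment of the response.  Integrability is required since the Bochner
   integral of a non-integrable function is 0. *)
definition asymptotic_convergence_conditions_on_average ::
  "'w measure \<Rightarrow> real \<Rightarrow> real \<Rightarrow> real \<Rightarrow> real \<Rightarrow> (real \<Rightarrow> real) \<Rightarrow> (nat \<Rightarrow> real Matrix.vec) \<Rightarrow>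
   (nat \<Rightarrow> 'w \<Rightarrow> physical_system) \<Rightarrow> bool"
where
  "asymptotic_convergence_conditions_on_average M L \<mu> \<alpha> \<gamma> f c \<phi> \<longleftrightarrow>
     (\<forall>\<omega> \<in> space M. conditions_A_to_E L \<mu> \<gamma> f c (\<lambda>n. \<phi> n \<omega>)) \<and>
     (\<forall>n\<ge>1. integrable M (\<lambda>\<omega>. sensitivity (c n) (\<phi> n \<omega>))) \<and>
     (\<lambda>n. \<integral>\<omega>. sensitivity (c n) (\<phi> n \<omega>) \<partial>M) \<in> \<Omega>(\<lambda>n. real n powr (\<alpha> + \<gamma>)) \<and>
     (\<forall>n\<ge>1. integrable M (\<lambda>\<omega>. \<bar>response (c n) (\<phi> n \<omega>)\<bar>\<^sup>2)) \<and>
     (\<lambda>n. \<integral>\<omega>. \<bar>response (c n) (\<phi> n \<omega>)\<bar>\<^sup>2 \<partial>M) \<in> O(\<lambda>_. 1)"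

end

theory Submission
  imports Defs "Jordan_Normal_Form.Determinant"
begin

text \<open>
Write \<open>t = 1 / s\<close> entrywise and \<open>T = diag t\<close>. Since \<open>R\<close> and \<open>Q\<close> are orthogonal,
\<open>A\<close> is invertible with inverse \<open>Q T R\<^sup>T\<close> (\<open>minv_svd\<close>), whose spectral norm is at most the
largest entry of \<open>t\<close> (\<open>op_norm_svd_inverse\<close>); this is (a). Parts (b) and (c) are statements about
moments of degree at most four in each of the Haar factors, and the two factors can be averaged one
after the other because they are independent.

For a Haar matrix \<open>Q\<close> the second moment is \<open>E (c \<bullet> Q u)\<^sup>2 = |c|\<^sup>2 |u|\<^sup>2 / n\<close>
(\<open>haar_second_moment\<close>). Averaging the square of the response \<open>c \<bullet> Q T R\<^sup>T b\<close> first over \<open>Q\<close>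
and then over \<open>R\<close> gives exactly \<open>|c|\<^sup>2 |b|\<^sup>2 |t|\<^sup>2 / n\<^sup>2\<close>, which is bounded because \<open>|t|\<close>
is of order \<open>n\<close>.

For the sensitivity, put \<open>x = A\<^sup>-\<^sup>1 b = Q u\<close> with \<open>u = T R\<^sup>T b\<close>. The \<open>i\<close>-th entry of
\<open>A\<^sup>-\<^sup>T c\<close> is \<open>c \<bullet> Q w\<close> with \<open>w = T R\<^sup>T e\<close> for the \<open>i\<close>-th unit vector \<open>e\<close>. For fixed \<open>R\<close> one
thus needs \<open>E (Q u)\<^sub>i\<^sup>2 (c \<bullet> Q w)\<^sup>2\<close>. The exact value is a Weingarten sum, but a lower bound
\<open>|c|\<^sup>2 |u|\<^sup>2 |w|\<^sup>2 / (3 n (n + 2))\<close> suffices, and it follows from invariance under three kinds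
of Householder reflections together with the inequality of arithmetic and geometric means
(\<open>haar_fourth_moment_lower_bound\<close>). Summed over \<open>i\<close>, the factors \<open>|w|\<^sup>2\<close> add up to \<open>|t|\<^sup>2\<close> for
every single \<open>R\<close>, so only the second moment of \<open>R\<close> is left to compute, and the mean sensitivity is
at least \<open>|c|\<^sup>2 |b|\<^sup>2 |t|\<^sup>4 / (3 n\<^sup>2 (n + 2))\<close>, which is of order \<open>n\<close>.

The norms of \<open>b\<close> and \<open>c\<close> enter only through \<open>|v|\<^sup>2\<close>, which lies between the square of the maximum
norm and the product of the maximum norm and the sum norm, hence between positive constants.
\<close>

section \<open>Bounded measurable entries\<close>

text \<open>
Every random variable below is a polynomial in the entries of orthogonal matrices. Bounded
measurable functions are closed under products, which integrable ones are not, so this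
predicate yields all integrability conditions compositionally.
\<close>

definition bounded_measurable :: "'x measure \<Rightarrow> ('x \<Rightarrow> real) \<Rightarrow> bool" where
  "bounded_measurable N f \<longleftrightarrow> f \<in> borel_measurable N \<and> (\<exists>K. \<forall>x\<in>space N. \<bar>f x\<bar> \<le> K)"

definition bounded_measurable_vec :: "'x measure \<Rightarrow> nat \<Rightarrow> ('x \<Rightarrow> real Matrix.vec) \<Rightarrow> bool" where
  "bounded_measurable_vec N n v \<longleftrightarrow>
     (\<forall>x\<in>space N. v x \<in> carrier_vec n) \<and> (\<forall>i<n. bounded_measurable N (\<lambda>x. v x $ i))"

definition bounded_measurable_mat :: "'x measure \<Rightarrow> nat \<Rightarrow> ('x \<Rightarrow> real Matrix.mat) \<Rightarrow> bool" where
  "bounded_measurable_mat N n X \<longleftrightarrow>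
     (\<forall>x\<in>space N. X x \<in> carrier_mat n n) \<and>
     (\<forall>i<n. \<forall>j<n. bounded_measurable N (\<lambda>x. X x $$ (i, j)))"

lemma bounded_measurable_cong:
  assumes "\<And>x. x \<in> space N \<Longrightarrow> f x = g x" "bounded_measurable N f"
  shows "bounded_measurable N g"
  using assms measurable_cong[of N f g borel] unfolding bounded_measurable_def by auto

lemma bounded_measurable_measurable: "bounded_measurable N f \<Longrightarrow> f \<in> borel_measurable N"
  by (simp add: bounded_measurable_def)

lemma bounded_measurable_const: "bounded_measurable N (\<lambda>_. k)"
  unfolding bounded_measurable_def by auto

lemma bounded_measurable_mult:
  assumes "bounded_measurable N f" "bounded_measurable N g"
  shows "bounded_measurable N (\<lambda>x. f x * g x)"
proof -
  obtain K K' where K: "\<And>x. x \<in> space N \<Longrightarrow> \<bar>f x\<bar> \<le> K" "\<And>x. x \<in> space N \<Longrightarrow> \<bar>g x\<bar> \<le> K'"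
    using assms unfolding bounded_measurable_def by blast
  have "\<bar>f x * g x\<bar> \<le> K * K'" if "x \<in> space N" for x
    unfolding abs_mult using K[OF that] by (intro mult_mono) auto
  moreover have "(\<lambda>x. f x * g x) \<in> borel_measurable N"
    using assms unfolding bounded_measurable_def by auto
  ultimately show ?thesis
    unfolding bounded_measurable_def by blast
qed

lemma bounded_measurable_add:
  assumes "bounded_measurable N f" "bounded_measurable N g"
  shows "bounded_measurable N (\<lambda>x. f x + g x)"
proof -
  obtain K K' where K: "\<And>x. x \<in> space N \<Longrightarrow> \<bar>f x\<bar> \<le> K" "\<And>x. x \<in> space N \<Longrightarrow> \<bar>g x\<bar> \<le> K'"
    using assms unfolding bounded_measurable_def by blast
  have "\<bar>f x + g x\<bar> \<le> K + K'" if "x \<in> space N" for x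
    using K[OF that] by linarith
  moreover have "(\<lambda>x. f x + g x) \<in> borel_measurable N"
    using assms unfolding bounded_measurable_def by auto
  ultimately show ?thesis
    unfolding bounded_measurable_def by blast
qed

lemma bounded_measurable_sum:
  assumes "\<And>i. i \<in> I \<Longrightarrow> bounded_measurable N (f i)"
  shows "bounded_measurable N (\<lambda>x. \<Sum>i\<in>I. f i x)"
  using assms
proof (induction I rule: infinite_finite_induct)
  case (insert i I)
  then show ?case
    using bounded_measurable_add[of N "f i" "\<lambda>x. \<Sum>i\<in>I. f i x"] by simp
qed (auto simp: bounded_measurable_const)

lemma bounded_measurable_power2:
  "bounded_measurable N f \<Longrightarrow> bounded_measurable N (\<lambda>x. (f x)\<^sup>2)"
  unfolding power2_eq_square by (rule bounded_measurable_mult)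

lemma bounded_measurable_compose:
  assumes "bounded_measurable N f" "T \<in> measurable N' N"
  shows "bounded_measurable N' (\<lambda>x. f (T x))"
proof -
  have "(\<lambda>x. f (T x)) \<in> borel_measurable N'"
    using measurable_compose[OF assms(2)] assms(1) unfolding bounded_measurable_def by blast
  moreover have "T x \<in> space N" if "x \<in> space N'" for x
    using measurable_space[OF assms(2) that] .
  ultimately show ?thesis
    using assms(1) unfolding bounded_measurable_def by blast
qed

lemma bounded_measurable_integrable:
  assumes "prob_space N" "bounded_measurable N f"
  shows "integrable N f"
proof -
  interpret prob_space N by fact
  obtain K where "\<And>x. x \<in> space N \<Longrightarrow> \<bar>f x\<bar> \<le> K"
    using assms(2) unfolding bounded_measurable_def by blast
  then show ?thesis
    using assms(2) by (intro integrable_const_bound[where B = K])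
      (auto simp: bounded_measurable_def)
qed

lemma bounded_measurable_vec_const: "v \<in> carrier_vec n \<Longrightarrow> bounded_measurable_vec N n (\<lambda>_. v)"
  by (auto simp: bounded_measurable_vec_def bounded_measurable_const)

lemma bounded_measurable_mat_const: "X \<in> carrier_mat n n \<Longrightarrow> bounded_measurable_mat N n (\<lambda>_. X)"
  by (auto simp: bounded_measurable_mat_def bounded_measurable_const)

lemma bounded_measurable_mat_transpose:
  assumes "bounded_measurable_mat N n X"
  shows "bounded_measurable_mat N n (\<lambda>x. (X x)\<^sup>T)"
proof -
  have "bounded_measurable N (\<lambda>x. (X x)\<^sup>T $$ (i, j))" if "i < n" "j < n" for i j
    by (rule bounded_measurable_cong[of N "\<lambda>x. X x $$ (j, i)"])
      (use assms that in \<open>auto simp: bounded_measurable_mat_def\<close>)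
  then show ?thesis
    using assms by (auto simp: bounded_measurable_mat_def)
qed

lemma bounded_measurable_scalar_prod:
  assumes "bounded_measurable_vec N n v" "bounded_measurable_vec N n w"
  shows "bounded_measurable N (\<lambda>x. v x \<bullet> w x)"
proof (rule bounded_measurable_cong)
  show "bounded_measurable N (\<lambda>x. \<Sum>i\<in>{0..<n}. v x $ i * w x $ i)"
    using assms unfolding bounded_measurable_vec_def
    by (intro bounded_measurable_sum bounded_measurable_mult) auto
  fix x assume "x \<in> space N"
  then have "w x \<in> carrier_vec n" using assms by (auto simp: bounded_measurable_vec_def)
  then show "(\<Sum>i\<in>{0..<n}. v x $ i * w x $ i) = v x \<bullet> w x"
    by (auto simp: scalar_prod_def)
qed

lemma bounded_measurable_mult_mat_vec:
  assumes "bounded_measurable_mat N n X" "bounded_measurable_vec N n v"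
  shows "bounded_measurable_vec N n (\<lambda>x. X x *\<^sub>v v x)"
proof -
  have "bounded_measurable N (\<lambda>x. (X x *\<^sub>v v x) $ i)" if i: "i < n" for i
  proof (rule bounded_measurable_cong)
    show "bounded_measurable N (\<lambda>x. \<Sum>k\<in>{0..<n}. X x $$ (i, k) * v x $ k)"
      using assms i unfolding bounded_measurable_vec_def bounded_measurable_mat_def
      by (intro bounded_measurable_sum bounded_measurable_mult) auto
    fix x assume "x \<in> space N"
    then have "v x \<in> carrier_vec n" "X x \<in> carrier_mat n n"
      using assms by (auto simp: bounded_measurable_vec_def bounded_measurable_mat_def)
    then show "(\<Sum>k\<in>{0..<n}. X x $$ (i, k) * v x $ k) = (X x *\<^sub>v v x) $ i"
      using i by (auto simp: scalar_prod_def)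
  qed
  then show ?thesis
    using assms by (auto simp: bounded_measurable_vec_def bounded_measurable_mat_def)
qed

lemma bounded_measurable_vec_index:
  "bounded_measurable_vec N n v \<Longrightarrow> i < n \<Longrightarrow> bounded_measurable N (\<lambda>x. v x $ i)"
  by (simp add: bounded_measurable_vec_def)

lemma bounded_measurable_mat_compose:
  assumes "bounded_measurable_mat N n X" "T \<in> measurable N' N"
  shows "bounded_measurable_mat N' n (\<lambda>x. X (T x))"
  using assms(1) bounded_measurable_compose[OF _ assms(2)] measurable_space[OF assms(2)]
  unfolding bounded_measurable_mat_def by blast

section \<open>Orthogonal matrices and the Haar measure\<close>

lemma orthogonal_mats_carrier: "Q \<in> orthogonal_mats n \<Longrightarrow> Q \<in> carrier_mat n n"
  by (simp add: orthogonal_mats_def)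

lemma orthogonal_mats_mult_transpose:
  assumes "Q \<in> orthogonal_mats n"
  shows "Q * Q\<^sup>T = 1\<^sub>m n"
  using assms mat_mult_left_right_inverse[of "Q\<^sup>T" n Q] by (auto simp: orthogonal_mats_def)

lemma orthogonal_mats_transpose: "Q \<in> orthogonal_mats n \<Longrightarrow> Q\<^sup>T \<in> orthogonal_mats n"
  using orthogonal_mats_mult_transpose[of Q n] by (auto simp: orthogonal_mats_def)

lemma orthogonal_mats_mult:
  assumes "U \<in> orthogonal_mats n" "Q \<in> orthogonal_mats n"
  shows "U * Q \<in> orthogonal_mats n"
proof -
  have [simp]: "U \<in> carrier_mat n n" "Q \<in> carrier_mat n n"
    using assms by (auto simp: orthogonal_mats_def)
  have "(U * Q)\<^sup>T * (U * Q) = Q\<^sup>T * (U\<^sup>T * U) * Q"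
    by (simp add: transpose_mult[of _ n n _ n] assoc_mult_mat[of _ n n _ n _ n]
        mult_carrier_mat[of _ n n _ n])
  then show ?thesis
    using assms mult_carrier_mat[of U n n Q n] right_mult_one_mat[of "Q\<^sup>T" n n]
    by (simp add: orthogonal_mats_def)
qed

lemma orthogonal_mats_scalar_prod:
  assumes Q: "Q \<in> orthogonal_mats n" and v: "v \<in> carrier_vec n" and w: "w \<in> carrier_vec n"
  shows "(Q *\<^sub>v v) \<bullet> (Q *\<^sub>v w) = v \<bullet> w"
proof -
  have [simp]: "Q \<in> carrier_mat n n" using Q by (rule orthogonal_mats_carrier)
  have "(Q *\<^sub>v v) \<bullet> (Q *\<^sub>v w) = (Q\<^sup>T *\<^sub>v (Q *\<^sub>v v)) \<bullet> w"
    using v w by (intro transpose_vec_mult_scalar[of Q n n, symmetric]) (use mult_mat_vec_carrier[of Q n n v] in auto)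
  also have "Q\<^sup>T *\<^sub>v (Q *\<^sub>v v) = v"
    using v Q by (simp add: assoc_mult_mat_vec[of _ n n _ n, symmetric] orthogonal_mats_def)
  finally show ?thesis .
qed

lemma orthogonal_mats_entry_le_1:
  assumes Q: "Q \<in> orthogonal_mats n" and "i < n" "j < n"
  shows "\<bar>Q $$ (i, j)\<bar> \<le> 1"
proof -
  have [simp]: "Q \<in> carrier_mat n n" using Q by (rule orthogonal_mats_carrier)
  have "(Q\<^sup>T * Q) $$ (j, j) = (\<Sum>k\<in>{0..<n}. (Q $$ (k, j))\<^sup>2)"
    using \<open>j < n\<close> carrier_matD[OF orthogonal_mats_carrier[OF Q]]
    by (simp add: scalar_prod_def power2_eq_square)
  moreover have "(Q\<^sup>T * Q) $$ (j, j) = 1"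
    using assms by (simp add: orthogonal_mats_def)
  ultimately have "(Q $$ (i, j))\<^sup>2 \<le> 1"
    using member_le_sum[of i "{0..<n}" "\<lambda>k. (Q $$ (k, j))\<^sup>2"] \<open>i < n\<close> by simp
  then show ?thesis by (simp add: abs_square_le_1)
qed

lemma space_borel_orthogonal [simp]: "space (borel_orthogonal n) = orthogonal_mats n"
  by (simp add: borel_orthogonal_def)

text \<open>The maps reading off single entries generate the Borel sets of the orthogonal group, and entries of
an orthogonal matrix are at most 1 in absolute value because its columns are unit vectors.\<close>

lemma bounded_measurable_orthogonal: "bounded_measurable_mat (borel_orthogonal n) n (\<lambda>Q. Q)"
proof -
  let ?I = "{..<n} \<times> {..<n}"
  have "(\<lambda>Q. \<lambda>ij\<in>?I. Q $$ ij) \<in> measurable (borel_orthogonal n) (PiM ?I (\<lambda>_. borel :: real measure))"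
    unfolding borel_orthogonal_def by (rule measurable_vimage_algebra1) (auto simp: space_PiM)
  from measurable_compose[OF this measurable_component_singleton]
  have "(\<lambda>Q. Q $$ (i, j)) \<in> borel_measurable (borel_orthogonal n)" if "i < n" "j < n" for i j
    using that by (force dest: meta_spec[of _ "(i, j)"])
  then show ?thesis
    unfolding bounded_measurable_mat_def bounded_measurable_def
    using orthogonal_mats_entry_le_1 by (fastforce intro: orthogonal_mats_carrier)
qed

text \<open>Needed to turn left invariance, an equation between image measures, into an equation
between integrals.\<close>

lemma measurable_orthogonal_mult:
  assumes "U \<in> orthogonal_mats n"
  shows "(\<lambda>Q. U * Q) \<in> measurable (borel_orthogonal n) (borel_orthogonal n)"
proof -
  let ?I = "{..<n} \<times> {..<n}"
  have U: "U \<in> carrier_mat n n" using assms by (rule orthogonal_mats_carrier)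
  have "(\<lambda>Q. (U * Q) $$ ij) \<in> borel_measurable (borel_orthogonal n)" if ij_in: "ij \<in> ?I" for ij
  proof -
    obtain i j where ij: "ij = (i, j)" "i < n" "j < n" using ij_in by auto
    show ?thesis
    proof (rule bounded_measurable_measurable, rule bounded_measurable_cong)
      show "bounded_measurable (borel_orthogonal n) (\<lambda>Q. \<Sum>k\<in>{0..<n}. U $$ (i, k) * Q $$ (k, j))"
        using ij bounded_measurable_orthogonal[of n] unfolding bounded_measurable_mat_def
        by (intro bounded_measurable_sum bounded_measurable_mult bounded_measurable_const) auto
      show "(\<Sum>k\<in>{0..<n}. U $$ (i, k) * Q $$ (k, j)) = (U * Q) $$ ij"
        if "Q \<in> space (borel_orthogonal n)" for Q
        using U orthogonal_mats_carrier[of Q n] that ij by (auto simp: scalar_prod_def)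
    qed
  qed
  then show ?thesis
    unfolding borel_orthogonal_def[of n]
    by (intro measurable_vimage_algebra2 measurable_restrict)
      (use assms in \<open>auto intro: orthogonal_mats_mult simp: borel_orthogonal_def[of n]\<close>)
qed

lemma haar_prob_space: "is_haar_orthogonal n \<nu> \<Longrightarrow> prob_space \<nu>"
  by (simp add: is_haar_orthogonal_def)

lemma haar_sets: "is_haar_orthogonal n \<nu> \<Longrightarrow> sets \<nu> = sets (borel_orthogonal n)"
  by (simp add: is_haar_orthogonal_def)

lemma haar_space: "is_haar_orthogonal n \<nu> \<Longrightarrow> space \<nu> = orthogonal_mats n"
  using sets_eq_imp_space_eq[OF haar_sets] by fastforce

lemma bounded_measurable_haar:
  assumes "is_haar_orthogonal n \<nu>"
  shows "bounded_measurable_mat \<nu> n (\<lambda>Q. Q)"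
  using bounded_measurable_orthogonal[of n] haar_space[OF assms]
    measurable_cong_sets[OF haar_sets[OF assms] refl, of "borel :: real measure"]
  unfolding bounded_measurable_mat_def bounded_measurable_def by simp

lemma haar_integral_left_mult:
  fixes g :: "real Matrix.mat \<Rightarrow> real"
  assumes "is_haar_orthogonal n \<nu>" "U \<in> orthogonal_mats n" "bounded_measurable \<nu> g"
  shows "(\<integral>Q. g (U * Q) \<partial>\<nu>) = (\<integral>Q. g Q \<partial>\<nu>)"
proof -
  have g: "g \<in> borel_measurable (borel_orthogonal n)"
    using bounded_measurable_measurable[OF assms(3)]
      measurable_cong_sets[OF haar_sets[OF assms(1)] refl] by blast
  have "(\<lambda>Q. U * Q) \<in> measurable \<nu> (borel_orthogonal n)"
    using measurable_orthogonal_mult[OF assms(2)]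
      measurable_cong_sets[OF haar_sets[OF assms(1)] refl] by blast
  from integral_distr[OF this g]
  have "(\<integral>Q. g (U * Q) \<partial>\<nu>) = (\<integral>Q. g Q \<partial>distr \<nu> (borel_orthogonal n) (\<lambda>Q. U * Q))" by simp
  also have "distr \<nu> (borel_orthogonal n) (\<lambda>Q. U * Q) = \<nu>"
    using assms(1,2) by (simp add: is_haar_orthogonal_def)
  finally show ?thesis .
qed

text \<open>The reflection in the hyperplane orthogonal to \<open>h\<close>, for arbitrary nonzero \<open>h\<close>: leaving \<open>h\<close>
unnormalised keeps all coefficients rational for the vectors used below.\<close>

definition householder :: "nat \<Rightarrow> real Matrix.vec \<Rightarrow> real Matrix.mat" where
  "householder n h =
     Matrix.mat n n (\<lambda>(k, l). (if k = l then 1 else 0) - 2 / (h \<bullet> h) * h $ k * h $ l)"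

lemma householder_mult_vec:
  assumes "h \<in> carrier_vec n" "x \<in> carrier_vec n" "k < n"
  shows "(householder n h *\<^sub>v x) $ k = x $ k - 2 * (h \<bullet> x) / (h \<bullet> h) * h $ k"
proof -
  have "(householder n h *\<^sub>v x) $ k =
      (\<Sum>l\<in>{0..<n}. (if k = l then x $ l else 0) - 2 / (h \<bullet> h) * h $ k * (h $ l * x $ l))"
    using assms by (auto simp: householder_def scalar_prod_def intro!: sum.cong simp: algebra_simps)
  also have "\<dots> = (\<Sum>l\<in>{0..<n}. if k = l then x $ l else 0)
      - 2 / (h \<bullet> h) * h $ k * (\<Sum>l\<in>{0..<n}. h $ l * x $ l)"
    by (simp only: sum_subtractf sum_distrib_left)
  also have "\<dots> = x $ k - 2 / (h \<bullet> h) * h $ k * (h \<bullet> x)"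
    using assms by (simp add: scalar_prod_def)
  finally show ?thesis by (simp add: algebra_simps)
qed

lemma householder_orthogonal:
  assumes h: "h \<in> carrier_vec n" and pos: "h \<bullet> h \<noteq> 0"
  shows "householder n h \<in> orthogonal_mats n"
proof -
  let ?H = "householder n h" and ?c = "2 / (h \<bullet> h)"
  have H: "?H \<in> carrier_mat n n" by (simp add: householder_def)
  have "(?H\<^sup>T * ?H) $$ (k, l) = 1\<^sub>m n $$ (k, l)" if "k < n" "l < n" for k l
  proof -
    have "(?H\<^sup>T * ?H) $$ (k, l) = (\<Sum>m\<in>{0..<n}.
        ((if m = k then 1 else 0) - ?c * h $ m * h $ k) * ((if m = l then 1 else 0) - ?c * h $ m * h $ l))"
      using that H by (auto simp: scalar_prod_def householder_def intro!: sum.cong)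
    also have "\<dots> = (\<Sum>m\<in>{0..<n}. (if m = k then (if k = l then 1 else 0) else 0)
        - (if m = k then ?c * h $ k * h $ l else 0) - (if m = l then ?c * h $ k * h $ l else 0)
        + ?c\<^sup>2 * h $ k * h $ l * (h $ m * h $ m))"
      by (intro sum.cong refl) (auto simp: algebra_simps power2_eq_square)
    also have "\<dots> = (if k = l then 1 else 0) - 2 * ?c * h $ k * h $ l + ?c\<^sup>2 * h $ k * h $ l * (h \<bullet> h)"
      using that h
      by (simp add: sum.distrib sum_subtractf sum_distrib_left[symmetric] scalar_prod_def)
    also have "\<dots> = (if k = l then 1 else 0)"
      using pos by (simp add: power2_eq_square)
    finally show ?thesis using that by simp
  qed
  then show ?thesis
    using H by (auto simp: orthogonal_mats_def intro!: eq_matI)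
qed

lemma haar_integral_reflect:
  fixes g :: "real Matrix.mat \<Rightarrow> real"
  assumes "is_haar_orthogonal n \<nu>" "h \<in> carrier_vec n" "h \<bullet> h \<noteq> 0" "bounded_measurable \<nu> g"
  shows "(\<integral>Q. g (householder n h * Q) \<partial>\<nu>) = (\<integral>Q. g Q \<partial>\<nu>)"
  by (rule haar_integral_left_mult[OF assms(1) householder_orthogonal[OF assms(2,3)] assms(4)])

text \<open>All moments are evaluated through this rule: the pair \<open>(Q u, Q w)\<close> has the same joint
law as its image under any reflection.\<close>

lemma haar_integral_reflect_vec:
  fixes F :: "real Matrix.vec \<Rightarrow> real Matrix.vec \<Rightarrow> real"
  assumes haar: "is_haar_orthogonal n \<nu>" and h: "h \<in> carrier_vec n" "h \<bullet> h \<noteq> 0"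
    and u: "u \<in> carrier_vec n" and w: "w \<in> carrier_vec n"
    and bm: "bounded_measurable \<nu> (\<lambda>Q. F (Q *\<^sub>v u) (Q *\<^sub>v w))"
  shows "(\<integral>Q. F (householder n h *\<^sub>v (Q *\<^sub>v u)) (householder n h *\<^sub>v (Q *\<^sub>v w)) \<partial>\<nu>)
    = (\<integral>Q. F (Q *\<^sub>v u) (Q *\<^sub>v w) \<partial>\<nu>)"
proof -
  have H: "householder n h \<in> carrier_mat n n" by (simp add: householder_def)
  have "(\<integral>Q. F (householder n h *\<^sub>v (Q *\<^sub>v u)) (householder n h *\<^sub>v (Q *\<^sub>v w)) \<partial>\<nu>) =
    (\<integral>Q. F ((householder n h * Q) *\<^sub>v u) ((householder n h * Q) *\<^sub>v w) \<partial>\<nu>)"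
  proof (rule Bochner_Integration.integral_cong[OF refl])
    fix Q assume "Q \<in> space \<nu>"
    then have "Q \<in> carrier_mat n n"
      using haar_space[OF haar] orthogonal_mats_carrier by auto
    then show "F (householder n h *\<^sub>v (Q *\<^sub>v u)) (householder n h *\<^sub>v (Q *\<^sub>v w)) =
      F ((householder n h * Q) *\<^sub>v u) ((householder n h * Q) *\<^sub>v w)"
      using assoc_mult_mat_vec[OF H _ u, of Q] assoc_mult_mat_vec[OF H _ w, of Q] by simp
  qed
  also have "\<dots> = (\<integral>Q. F (Q *\<^sub>v u) (Q *\<^sub>v w) \<partial>\<nu>)"
    by (rule haar_integral_reflect[OF haar h bm])
  finally show ?thesis .
qed

lemma householder_sign:
  assumes "x \<in> carrier_vec n" "a < n" "k < n"
  shows "(householder n (unit_vec n a) *\<^sub>v x) $ k = (if k = a then - x $ k else x $ k)"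
  using assms by (subst householder_mult_vec) auto

lemma householder_swap:
  assumes "x \<in> carrier_vec n" "a < n" "b < n" "a \<noteq> b" "k < n"
  shows "(householder n (unit_vec n a - unit_vec n b) *\<^sub>v x) $ k
    = (if k = a then x $ b else if k = b then x $ a else x $ k)"
proof -
  have *: "(unit_vec n a - unit_vec n b) \<bullet> y = y $ a - y $ b" if "y \<in> carrier_vec n" for y :: "real Matrix.vec"
    using that assms by (subst minus_scalar_prod_distrib[of _ n]) auto
  show ?thesis
    using assms by (subst householder_mult_vec) (auto simp: * field_simps)
qed

text \<open>The vector \<open>(1, -2)\<close> has squared norm 5, which makes the reflection the Pythagorean one with entries
\<open>3/5\<close> and \<open>4/5\<close>. Sign changes and transpositions leave the fourth moments with equal and with
different indices unrelated; this reflection relates them.\<close>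

lemma householder_mix:
  assumes "x \<in> carrier_vec n" "a < n" "b < n" "a \<noteq> b"
  shows "(householder n (unit_vec n a - 2 \<cdot>\<^sub>v unit_vec n b) *\<^sub>v x) $ a = (3 * x $ a + 4 * x $ b) / 5"
proof -
  have *: "(unit_vec n a - 2 \<cdot>\<^sub>v unit_vec n b) \<bullet> y = y $ a - 2 * y $ b" if "y \<in> carrier_vec n" for y :: "real Matrix.vec"
    using that assms by (subst minus_scalar_prod_distrib[of _ n]) auto
  show ?thesis
    using assms by (subst householder_mult_vec) (auto simp: * field_simps)
qed

section \<open>Second and fourth moments of a Haar matrix\<close>

lemma square_scalar_prod:
  fixes c x :: "real Matrix.vec"
  assumes "c \<in> carrier_vec n" "x \<in> carrier_vec n"
  shows "(c \<bullet> x)\<^sup>2 = (\<Sum>i<n. \<Sum>j<n. c $ i * c $ j * (x $ i * x $ j))"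
proof -
  have "(c \<bullet> x)\<^sup>2 = (\<Sum>i<n. c $ i * x $ i) * (\<Sum>j<n. c $ j * x $ j)"
    using assms by (simp add: scalar_prod_def power2_eq_square atLeast0LessThan)
  also have "\<dots> = (\<Sum>i<n. \<Sum>j<n. c $ i * c $ j * (x $ i * x $ j))"
    unfolding sum_product by (intro sum.cong refl) (simp add: ac_simps)
  finally show ?thesis .
qed

lemma sum_sq_vec: "v \<bullet> v = (\<Sum>i<dim_vec v. (v $ i)\<^sup>2)" for v :: "real Matrix.vec"
  by (simp add: scalar_prod_def power2_eq_square atLeast0LessThan)

context
  fixes n :: nat and \<nu> :: "real Matrix.mat measure" and u :: "real Matrix.vec"
  assumes haar: "is_haar_orthogonal n \<nu>" and u: "u \<in> carrier_vec n"
begin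

lemma haar_image_carrier:
  assumes "Q \<in> space \<nu>"
  shows "Q *\<^sub>v u \<in> carrier_vec n"
  using mult_mat_vec_carrier[OF orthogonal_mats_carrier u] assms haar_space[OF haar] by blast

lemma bounded_measurable_coord: "i < n \<Longrightarrow> bounded_measurable \<nu> (\<lambda>Q. (Q *\<^sub>v u) $ i)"
  using bounded_measurable_haar[OF haar] u
  by (intro bounded_measurable_vec_index[of _ n] bounded_measurable_mult_mat_vec
      bounded_measurable_vec_const)

lemma haar_norm_image:
  assumes "Q \<in> space \<nu>"
  shows "(\<Sum>i<n. ((Q *\<^sub>v u) $ i)\<^sup>2) = u \<bullet> u"
  using orthogonal_mats_scalar_prod[of Q n u u] assms u haar_space[OF haar]
    sum_sq_vec[of "Q *\<^sub>v u"] carrier_vecD[OF haar_image_carrier[OF assms]] by simp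

text \<open>Reflecting in the \<open>i\<close>-th coordinate changes the sign of the integrand.\<close>

lemma haar_second_moment_off_diagonal:
  assumes "i < n" "j < n" "i \<noteq> j"
  shows "(\<integral>Q. (Q *\<^sub>v u) $ i * (Q *\<^sub>v u) $ j \<partial>\<nu>) = 0"
proof -
  let ?H = "householder n (unit_vec n i)"
  have "(\<integral>Q. (Q *\<^sub>v u) $ i * (Q *\<^sub>v u) $ j \<partial>\<nu>)
      = (\<integral>Q. (?H *\<^sub>v (Q *\<^sub>v u)) $ i * (?H *\<^sub>v (Q *\<^sub>v u)) $ j \<partial>\<nu>)"
    using assms
    by (intro haar_integral_reflect_vec[OF haar _ _ u u, symmetric, where F = "\<lambda>x y. x $ i * x $ j"]
        bounded_measurable_mult bounded_measurable_coord) auto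
  also have "\<dots> = (\<integral>Q. - ((Q *\<^sub>v u) $ i * (Q *\<^sub>v u) $ j) \<partial>\<nu>)"
    using assms haar_image_carrier
    by (intro Bochner_Integration.integral_cong refl) (simp add: householder_sign)
  finally show ?thesis by simp
qed

text \<open>Exchanging coordinates shows that all \<open>n\<close> of these moments agree, and they sum to \<open>|u|\<^sup>2\<close> because \<open>Q\<close>
preserves the norm.\<close>

lemma haar_second_moment_diagonal:
  assumes "i < n"
  shows "(\<integral>Q. ((Q *\<^sub>v u) $ i)\<^sup>2 \<partial>\<nu>) = (u \<bullet> u) / n"
proof -
  interpret prob_space \<nu> by (rule haar_prob_space[OF haar])
  have eq: "(\<integral>Q. ((Q *\<^sub>v u) $ j)\<^sup>2 \<partial>\<nu>) = (\<integral>Q. ((Q *\<^sub>v u) $ i)\<^sup>2 \<partial>\<nu>)" if "j < n" "j \<noteq> i" for j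
  proof -
    let ?h = "unit_vec n i - unit_vec n j :: real Matrix.vec"
    let ?H = "householder n ?h"
    have "?h \<bullet> ?h = 2"
      using that assms by (subst minus_scalar_prod_distrib[of _ n]) auto
    then have "(\<integral>Q. ((Q *\<^sub>v u) $ i)\<^sup>2 \<partial>\<nu>) = (\<integral>Q. ((?H *\<^sub>v (Q *\<^sub>v u)) $ i)\<^sup>2 \<partial>\<nu>)"
      using assms that
      by (intro haar_integral_reflect_vec[OF haar _ _ u u, symmetric, where F = "\<lambda>x y. (x $ i)\<^sup>2"]
          bounded_measurable_power2 bounded_measurable_coord) auto
    also have "\<dots> = (\<integral>Q. ((Q *\<^sub>v u) $ j)\<^sup>2 \<partial>\<nu>)"
      using assms that haar_image_carrier
      by (intro Bochner_Integration.integral_cong refl) (simp add: householder_swap)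
    finally show ?thesis ..
  qed
  have "n * (\<integral>Q. ((Q *\<^sub>v u) $ i)\<^sup>2 \<partial>\<nu>) = (\<Sum>j<n. (\<integral>Q. ((Q *\<^sub>v u) $ i)\<^sup>2 \<partial>\<nu>))"
    by simp
  also have "\<dots> = (\<Sum>j<n. (\<integral>Q. ((Q *\<^sub>v u) $ j)\<^sup>2 \<partial>\<nu>))"
    using eq by (intro sum.cong refl) (metis lessThan_iff)
  also have "\<dots> = (\<integral>Q. (\<Sum>j<n. ((Q *\<^sub>v u) $ j)\<^sup>2) \<partial>\<nu>)"
    by (intro Bochner_Integration.integral_sum[symmetric] bounded_measurable_integrable
        bounded_measurable_power2 bounded_measurable_coord prob_space_axioms) auto
  also have "\<dots> = (\<integral>Q. u \<bullet> u \<partial>\<nu>)"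
    by (intro Bochner_Integration.integral_cong refl haar_norm_image)
  also have "\<dots> = u \<bullet> u" by (simp add: prob_space)
  finally show ?thesis using assms by (simp add: field_simps)
qed

text \<open>Expanding the square leaves only the diagonal terms.\<close>

lemma haar_second_moment:
  assumes c: "c \<in> carrier_vec n"
  shows "(\<integral>Q. (c \<bullet> (Q *\<^sub>v u))\<^sup>2 \<partial>\<nu>) = (c \<bullet> c) * (u \<bullet> u) / n"
proof -
  have ps: "prob_space \<nu>" by (rule haar_prob_space[OF haar])
  have "(\<integral>Q. (c \<bullet> (Q *\<^sub>v u))\<^sup>2 \<partial>\<nu>)
    = (\<integral>Q. (\<Sum>i<n. \<Sum>j<n. c $ i * c $ j * ((Q *\<^sub>v u) $ i * (Q *\<^sub>v u) $ j)) \<partial>\<nu>)"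
    using c haar_image_carrier
    by (intro Bochner_Integration.integral_cong refl square_scalar_prod) auto
  also have "\<dots> = (\<Sum>i<n. \<Sum>j<n. (\<integral>Q. c $ i * c $ j * ((Q *\<^sub>v u) $ i * (Q *\<^sub>v u) $ j) \<partial>\<nu>))"
    by (subst Bochner_Integration.integral_sum Bochner_Integration.integral_sum,
        (intro bounded_measurable_integrable[OF ps] bounded_measurable_sum bounded_measurable_mult
          bounded_measurable_const bounded_measurable_coord; simp)+)
       (intro sum.cong refl Bochner_Integration.integral_sum
          bounded_measurable_integrable[OF ps] bounded_measurable_mult
          bounded_measurable_const bounded_measurable_coord; simp)
  also have "\<dots> = (\<Sum>i<n. \<Sum>j<n. if i = j then c $ i * c $ i * ((u \<bullet> u) / n) else 0)"
    by (intro sum.cong refl)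
      (auto simp: haar_second_moment_off_diagonal haar_second_moment_diagonal
        simp flip: power2_eq_square)
  also have "\<dots> = (\<Sum>i<n. c $ i * c $ i * ((u \<bullet> u) / n))"
    by simp
  also have "\<dots> = (\<Sum>i<n. c $ i * c $ i) * ((u \<bullet> u) / n)"
    by (rule sum_distrib_right[symmetric])
  also have "\<dots> = (c \<bullet> c) * (u \<bullet> u) / n"
    using c by (simp add: scalar_prod_def[of c c] atLeast0LessThan)
  finally show ?thesis .
qed

end

context
  fixes n :: nat and \<nu> :: "real Matrix.mat measure" and u w :: "real Matrix.vec"
  assumes haar: "is_haar_orthogonal n \<nu>" and u: "u \<in> carrier_vec n" and w: "w \<in> carrier_vec n"
begin

lemmas image_carriers = haar_image_carrier[OF haar u] haar_image_carrier[OF haar w]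

lemmas bounded_measurable_coords =
  bounded_measurable_coord[OF haar u] bounded_measurable_coord[OF haar w]

lemma haar_moment_reflect:
  assumes h: "h \<in> carrier_vec n" "h \<bullet> h \<noteq> 0" and ijkl: "i < n" "j < n" "k < n" "l < n"
  defines "H \<equiv> householder n h"
  shows "(\<integral>Q. (H *\<^sub>v (Q *\<^sub>v u)) $ i * (H *\<^sub>v (Q *\<^sub>v u)) $ j * (H *\<^sub>v (Q *\<^sub>v w)) $ k
      * (H *\<^sub>v (Q *\<^sub>v w)) $ l \<partial>\<nu>)
    = (\<integral>Q. (Q *\<^sub>v u) $ i * (Q *\<^sub>v u) $ j * (Q *\<^sub>v w) $ k * (Q *\<^sub>v w) $ l \<partial>\<nu>)"
  unfolding H_def using ijkl
  by (intro haar_integral_reflect_vec[OF haar h u w,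
        where F = "\<lambda>x y. x $ i * x $ j * y $ k * y $ l"] bounded_measurable_mult
      bounded_measurable_coords)

text \<open>As \<open>i\<close> occurs twice and \<open>j\<close> differs from \<open>l\<close>, coordinate \<open>j\<close> occurs an odd number of times in the
product, also when \<open>j = i\<close>. Changing its sign changes the sign of the integrand.\<close>

lemma haar_fourth_moment_odd:
  assumes i: "i < n" and j: "j < n" and l: "l < n" and "j \<noteq> l" 
  shows "(\<integral>Q. (Q *\<^sub>v u) $ i * (Q *\<^sub>v u) $ i * (Q *\<^sub>v w) $ j * (Q *\<^sub>v w) $ l \<partial>\<nu>) = 0"
proof -
  let ?H = "householder n (unit_vec n j)"
  have "(\<integral>Q. (Q *\<^sub>v u) $ i * (Q *\<^sub>v u) $ i * (Q *\<^sub>v w) $ j * (Q *\<^sub>v w) $ l \<partial>\<nu>)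
      = (\<integral>Q. (?H *\<^sub>v (Q *\<^sub>v u)) $ i * (?H *\<^sub>v (Q *\<^sub>v u)) $ i * (?H *\<^sub>v (Q *\<^sub>v w)) $ j
          * (?H *\<^sub>v (Q *\<^sub>v w)) $ l \<partial>\<nu>)"
    using assms by (intro haar_moment_reflect[symmetric]) auto
  also have "\<dots> = (\<integral>Q. - ((Q *\<^sub>v u) $ i * (Q *\<^sub>v u) $ i * (Q *\<^sub>v w) $ j * (Q *\<^sub>v w) $ l) \<partial>\<nu>)"
    using assms image_carriers
    by (intro Bochner_Integration.integral_cong refl) (auto simp: householder_sign)
  finally show ?thesis by simp
qed

definition square_moment :: "nat \<Rightarrow> nat \<Rightarrow> real" where
  "square_moment i j = (\<integral>Q. ((Q *\<^sub>v u) $ i)\<^sup>2 * ((Q *\<^sub>v w) $ j)\<^sup>2 \<partial>\<nu>)"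

lemma square_moment_eq:
  "square_moment i j = (\<integral>Q. (Q *\<^sub>v u) $ i * (Q *\<^sub>v u) $ i * (Q *\<^sub>v w) $ j * (Q *\<^sub>v w) $ j \<partial>\<nu>)"
  by (simp add: square_moment_def power2_eq_square mult.assoc)

lemma square_moment_swap:
  assumes "a < n" "b < n" "a \<noteq> b" "i < n" "j < n"
  shows "square_moment i j = square_moment (Transposition.transpose a b i) (Transposition.transpose a b j)"
proof -
  let ?h = "unit_vec n a - unit_vec n b :: real Matrix.vec"
  let ?H = "householder n ?h"
  have "?h \<bullet> ?h = 2"
    using assms by (subst minus_scalar_prod_distrib[of _ n]) auto
  then have "square_moment i j = (\<integral>Q. (?H *\<^sub>v (Q *\<^sub>v u)) $ i * (?H *\<^sub>v (Q *\<^sub>v u)) $ i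
      * (?H *\<^sub>v (Q *\<^sub>v w)) $ j * (?H *\<^sub>v (Q *\<^sub>v w)) $ j \<partial>\<nu>)"
    unfolding square_moment_eq using assms by (intro haar_moment_reflect[symmetric]) auto
  also have "\<dots> = square_moment (Transposition.transpose a b i) (Transposition.transpose a b j)"
    unfolding square_moment_eq using assms image_carriers
    by (intro Bochner_Integration.integral_cong refl)
      (simp add: householder_swap Transposition.transpose_def)
  finally show ?thesis .
qed

text \<open>By exchanging coordinates, the moments \<open>E (Q u)\<^sub>i\<^sup>2 (Q w)\<^sub>j\<^sup>2\<close> take only two values, one for
\<open>i = j\<close> and one for \<open>i \<noteq> j\<close>.\<close>

lemma square_moment_diagonal_eq:
  assumes "i < n" "j < n"
  shows "square_moment i i = square_moment j j"
  using square_moment_swap[of i j i i] assms by (cases "i = j") auto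

lemma square_moment_off_diagonal_eq:
  assumes "i < n" "j < n" "i \<noteq> j" "k < n" "l < n" "k \<noteq> l"
  shows "square_moment i j = square_moment k l"
proof -
  have sym: "square_moment a b = square_moment b a" if "a < n" "b < n" "a \<noteq> b" for a b
    using square_moment_swap[of a b a b] that by simp
  have snd: "square_moment a b = square_moment a d" if "a < n" "b < n" "d < n" "a \<noteq> b" "a \<noteq> d" for a b d
    using square_moment_swap[of b d a b] that by (cases "b = d") (auto simp: Transposition.transpose_def)
  show ?thesis
    using assms sym snd by (cases "i = l") metis+
qed

lemma square_moment_nonneg: "square_moment i j \<ge> 0"
  unfolding square_moment_def by (intro Bochner_Integration.integral_nonneg) auto

text \<open>With \<open>v = Q u\<close> and \<open>z = Q w\<close>, the reflection with entries \<open>3/5\<close> and \<open>4/5\<close> gives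
\<open>625 p = E (3 v\<^sub>i + 4 v\<^sub>j)\<^sup>2 (3 z\<^sub>i + 4 z\<^sub>j)\<^sup>2\<close> for the diagonal moment \<open>p\<close>. The right-hand side is
\<open>337 p + 288 q + 576 r\<close>, where \<open>q\<close> is the off-diagonal moment and \<open>r\<close> the mixed one, so
\<open>p = q + 2 r\<close>.\<close>

lemma square_moment_mix:
  assumes "i < n" "j < n" "i \<noteq> j"
  shows "square_moment i i = square_moment i j +
    2 * (\<integral>Q. (Q *\<^sub>v u) $ i * (Q *\<^sub>v u) $ j * (Q *\<^sub>v w) $ i * (Q *\<^sub>v w) $ j \<partial>\<nu>)"
proof -
  have ps: "prob_space \<nu>" by (rule haar_prob_space[OF haar])
  let ?h = "unit_vec n i - 2 \<cdot>\<^sub>v unit_vec n j :: real Matrix.vec"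
  let ?H = "householder n ?h"
  let ?s = "householder n (unit_vec n j)"
  define r where "r = (\<integral>Q. (Q *\<^sub>v u) $ i * (Q *\<^sub>v u) $ j * (Q *\<^sub>v w) $ i * (Q *\<^sub>v w) $ j \<partial>\<nu>)"
  let ?G = "\<lambda>x y :: real Matrix.vec. (3 * x $ i + 4 * x $ j)\<^sup>2 * (3 * y $ i + 4 * y $ j)\<^sup>2"
  let ?P = "\<lambda>x y :: real Matrix.vec. 162 * ((x $ i)\<^sup>2 * (y $ i)\<^sup>2) + 512 * ((x $ j)\<^sup>2 * (y $ j)\<^sup>2)
     + 288 * ((x $ i)\<^sup>2 * (y $ j)\<^sup>2) + 288 * ((x $ j)\<^sup>2 * (y $ i)\<^sup>2)
     + 1152 * (x $ i * x $ j * y $ i * y $ j)"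
  have "?h \<bullet> ?h = 5"
    using assms by (subst minus_scalar_prod_distrib[of _ n]) auto
  then have "square_moment i i = (\<integral>Q. (?H *\<^sub>v (Q *\<^sub>v u)) $ i * (?H *\<^sub>v (Q *\<^sub>v u)) $ i
      * (?H *\<^sub>v (Q *\<^sub>v w)) $ i * (?H *\<^sub>v (Q *\<^sub>v w)) $ i \<partial>\<nu>)"
    unfolding square_moment_eq using assms by (intro haar_moment_reflect[symmetric]) auto
  also have "\<dots> = (\<integral>Q. ?G (Q *\<^sub>v u) (Q *\<^sub>v w) / 625 \<partial>\<nu>)"
    using assms image_carriers
    by (intro Bochner_Integration.integral_cong refl)
      (simp add: householder_mix power2_eq_square)
  finally have 1: "(\<integral>Q. ?G (Q *\<^sub>v u) (Q *\<^sub>v w) \<partial>\<nu>) = 625 * square_moment i i" by simp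
  \<comment> \<open>Changing the sign of coordinate \<open>j\<close> turns \<open>?G\<close> into \<open>?G'\<close>; in the sum of the two the
    monomials that are odd in \<open>j\<close> cancel, which leaves \<open>?P\<close>.\<close>
  have bmG: "bounded_measurable \<nu> (\<lambda>Q. ?G (Q *\<^sub>v u) (Q *\<^sub>v w))"
    using assms
    by (intro bounded_measurable_mult bounded_measurable_power2 bounded_measurable_add
      bounded_measurable_const bounded_measurable_coords) 
  have "(\<integral>Q. ?G (Q *\<^sub>v u) (Q *\<^sub>v w) \<partial>\<nu>) = (\<integral>Q. ?G (?s *\<^sub>v (Q *\<^sub>v u)) (?s *\<^sub>v (Q *\<^sub>v w)) \<partial>\<nu>)"
    using assms by (intro haar_integral_reflect_vec[OF haar _ _ u w bmG, symmetric]) auto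
  also have "\<dots> = (\<integral>Q. (3 * (Q *\<^sub>v u) $ i - 4 * (Q *\<^sub>v u) $ j)\<^sup>2
      * (3 * (Q *\<^sub>v w) $ i - 4 * (Q *\<^sub>v w) $ j)\<^sup>2 \<partial>\<nu>)" (is "_ = (\<integral>Q. ?G' Q \<partial>\<nu>)")
    using assms image_carriers
    by (intro Bochner_Integration.integral_cong refl) (simp add: householder_sign)
  finally have 2: "(\<integral>Q. ?G' Q \<partial>\<nu>) = 625 * square_moment i i" using 1 by simp
  have 3: "?G (Q *\<^sub>v u) (Q *\<^sub>v w) = ?P (Q *\<^sub>v u) (Q *\<^sub>v w) - ?G' Q" for Q
    by (simp add: power2_eq_square algebra_simps)
  have bm: "bounded_measurable \<nu> (\<lambda>Q. ((Q *\<^sub>v u) $ a)\<^sup>2 * ((Q *\<^sub>v w) $ b)\<^sup>2)"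
      "bounded_measurable \<nu> (\<lambda>Q. (Q *\<^sub>v u) $ i * (Q *\<^sub>v u) $ j * (Q *\<^sub>v w) $ i * (Q *\<^sub>v w) $ j)"
      if "a < n" "b < n" for a b
    using assms that
    by (intro bounded_measurable_mult bounded_measurable_power2 bounded_measurable_coords; simp)+
  note int = bounded_measurable_integrable[OF ps bm(1)]
    bounded_measurable_integrable[OF ps bm(2)[OF assms(1,2)]]
  have "bounded_measurable \<nu> ?G'"
    unfolding diff_conv_add_uminus mult_minus_left[symmetric] using assms
    by (intro bounded_measurable_mult bounded_measurable_power2 bounded_measurable_add
      bounded_measurable_const bounded_measurable_coords) 
  then have intG': "integrable \<nu> ?G'" by (rule bounded_measurable_integrable[OF ps])
  have intP: "integrable \<nu> (\<lambda>Q. ?P (Q *\<^sub>v u) (Q *\<^sub>v w))"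
    using assms by (intro Bochner_Integration.integrable_add integrable_mult_right int) 
  have "(\<integral>Q. ?P (Q *\<^sub>v u) (Q *\<^sub>v w) \<partial>\<nu>) = (\<integral>Q. ?G (Q *\<^sub>v u) (Q *\<^sub>v w) \<partial>\<nu>) + (\<integral>Q. ?G' Q \<partial>\<nu>)"
    unfolding 3 by (simp only: Bochner_Integration.integral_diff[OF intP intG'] diff_add_cancel)
  also have "\<dots> = 1250 * square_moment i i" using 1 2 by simp
  also have "(\<integral>Q. ?P (Q *\<^sub>v u) (Q *\<^sub>v w) \<partial>\<nu>)
      = 162 * square_moment i i + 512 * square_moment j j + 288 * square_moment i j + 288 * square_moment j i + 1152 * r"
    using assms unfolding square_moment_def r_def by (simp add: int)
  finally show ?thesis
    using square_moment_diagonal_eq[of i j] square_moment_off_diagonal_eq[of i j j i] assms unfolding r_def by simp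
qed

text \<open>In \<open>p = q + 2 r\<close> the mixed moment \<open>r = E v\<^sub>i v\<^sub>j z\<^sub>i z\<^sub>j\<close> satisfies \<open>- p \<le> r \<le> q\<close>: the two bounds come from
the two ways to split its integrand into a product of two factors, \<open>(v\<^sub>i z\<^sub>i) (v\<^sub>j z\<^sub>j)\<close> and
\<open>(v\<^sub>i z\<^sub>j) (v\<^sub>j z\<^sub>i)\<close>, and the inequality of arithmetic and geometric means.\<close>

lemma square_moment_compare:
  assumes "i < n" "j < n" "i \<noteq> j"
  shows "square_moment i i \<le> 3 * square_moment i j" "square_moment i j \<le> 3 * square_moment i i"
proof -
  have ps: "prob_space \<nu>" by (rule haar_prob_space[OF haar])
  let ?r = "\<lambda>Q. (Q *\<^sub>v u) $ i * (Q *\<^sub>v u) $ j * (Q *\<^sub>v w) $ i * (Q *\<^sub>v w) $ j"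
  have int: "integrable \<nu> (\<lambda>Q. ((Q *\<^sub>v u) $ a)\<^sup>2 * ((Q *\<^sub>v w) $ b)\<^sup>2)" "integrable \<nu> ?r"
    if "a < n" "b < n" for a b
    using assms that by (intro bounded_measurable_integrable[OF ps] bounded_measurable_mult
        bounded_measurable_power2 bounded_measurable_coords; simp)+
  have amgm: "2 * x * y \<le> x\<^sup>2 + y\<^sup>2" "- (2 * x * y) \<le> x\<^sup>2 + y\<^sup>2" for x y :: real
    using sum_squares_ge_zero[of "x - y" 0] sum_squares_ge_zero[of "x + y" 0]
    by (simp_all add: power2_eq_square algebra_simps)
  have "(\<integral>Q. 2 * ?r Q \<partial>\<nu>)
    \<le> (\<integral>Q. ((Q *\<^sub>v u) $ i)\<^sup>2 * ((Q *\<^sub>v w) $ j)\<^sup>2 + ((Q *\<^sub>v u) $ j)\<^sup>2 * ((Q *\<^sub>v w) $ i)\<^sup>2 \<partial>\<nu>)"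
  proof (rule integral_mono)
    show "2 * ?r Q \<le> ((Q *\<^sub>v u) $ i)\<^sup>2 * ((Q *\<^sub>v w) $ j)\<^sup>2 + ((Q *\<^sub>v u) $ j)\<^sup>2 * ((Q *\<^sub>v w) $ i)\<^sup>2" for Q
      using amgm(1)[of "(Q *\<^sub>v u) $ i * (Q *\<^sub>v w) $ j" "(Q *\<^sub>v u) $ j * (Q *\<^sub>v w) $ i"]
      by (simp add: power_mult_distrib ac_simps)
  qed (use int assms in auto)
  also have "\<dots> = square_moment i j + square_moment j i" using assms unfolding square_moment_def by (simp add: int)
  finally have upper: "2 * integral\<^sup>L \<nu> ?r \<le> square_moment i j + square_moment j i" by simp
  have "(\<integral>Q. - (2 * ?r Q) \<partial>\<nu>)
    \<le> (\<integral>Q. ((Q *\<^sub>v u) $ i)\<^sup>2 * ((Q *\<^sub>v w) $ i)\<^sup>2 + ((Q *\<^sub>v u) $ j)\<^sup>2 * ((Q *\<^sub>v w) $ j)\<^sup>2 \<partial>\<nu>)"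
  proof (rule integral_mono)
    show "- (2 * ?r Q) \<le> ((Q *\<^sub>v u) $ i)\<^sup>2 * ((Q *\<^sub>v w) $ i)\<^sup>2 + ((Q *\<^sub>v u) $ j)\<^sup>2 * ((Q *\<^sub>v w) $ j)\<^sup>2" for Q
      using amgm(2)[of "(Q *\<^sub>v u) $ i * (Q *\<^sub>v w) $ i" "(Q *\<^sub>v u) $ j * (Q *\<^sub>v w) $ j"]
      by (simp add: power_mult_distrib ac_simps)
  qed (use int assms in auto)
  also have "\<dots> = square_moment i i + square_moment j j" using assms unfolding square_moment_def by (simp add: int)
  finally have lower: "- (2 * integral\<^sup>L \<nu> ?r) \<le> square_moment i i + square_moment j j" by simp
  show "square_moment i i \<le> 3 * square_moment i j" "square_moment i j \<le> 3 * square_moment i i"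
    using square_moment_mix[OF assms] square_moment_diagonal_eq[of i j] square_moment_off_diagonal_eq[of i j j i] assms upper lower
    by auto
qed

text \<open>The moments add up to \<open>|u|\<^sup>2 |w|\<^sup>2 = n p + n (n - 1) q\<close>. As \<open>p\<close> and \<open>q\<close> are within a factor 3 of each
other, this is at most \<open>n (n + 2) q\<close>, and neither moment is less than \<open>q / 3\<close>.\<close>

lemma square_moment_lower_bound:
  assumes "i < n" "j < n" "n \<ge> 2"
  shows "(u \<bullet> u) * (w \<bullet> w) \<le> 3 * n * (n + 2) * square_moment i j"
proof -
  interpret prob_space \<nu> by (rule haar_prob_space[OF haar])
  define q where "q = square_moment 0 1"
  have off: "square_moment k l = q" if "k < n" "l < n" "k \<noteq> l" for k l
    unfolding q_def using that assms by (intro square_moment_off_diagonal_eq) auto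
  have dia: "square_moment k k \<le> 3 * q" "q \<le> 3 * square_moment k k" if "k < n" for k
    using square_moment_compare[of 0 1] square_moment_diagonal_eq[of k 0] that assms unfolding q_def by auto
  have bm: "bounded_measurable \<nu> (\<lambda>Q. ((Q *\<^sub>v u) $ k)\<^sup>2 * ((Q *\<^sub>v w) $ l)\<^sup>2)" if "k < n" "l < n" for k l
    using that by (intro bounded_measurable_mult bounded_measurable_power2 bounded_measurable_coords)
  have "(u \<bullet> u) * (w \<bullet> w) = (\<integral>Q. (u \<bullet> u) * (w \<bullet> w) \<partial>\<nu>)" by (simp add: prob_space)
  also have "\<dots> = (\<integral>Q. (\<Sum>k<n. \<Sum>l<n. ((Q *\<^sub>v u) $ k)\<^sup>2 * ((Q *\<^sub>v w) $ l)\<^sup>2) \<partial>\<nu>)"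
    by (intro Bochner_Integration.integral_cong refl)
      (simp add: haar_norm_image[OF haar u] haar_norm_image[OF haar w] flip: sum_product)
  also have "\<dots> = (\<Sum>k<n. (\<integral>Q. (\<Sum>l<n. ((Q *\<^sub>v u) $ k)\<^sup>2 * ((Q *\<^sub>v w) $ l)\<^sup>2) \<partial>\<nu>))"
    by (intro Bochner_Integration.integral_sum bounded_measurable_integrable[OF prob_space_axioms]
        bounded_measurable_sum bm) auto
  also have "\<dots> = (\<Sum>k<n. \<Sum>l<n. square_moment k l)"
    unfolding square_moment_def
    by (intro sum.cong refl Bochner_Integration.integral_sum
        bounded_measurable_integrable[OF prob_space_axioms] bm) auto
  also have "\<dots> \<le> (\<Sum>k<n. \<Sum>l<n. q + (if k = l then 2 * q else 0))"
    using off dia by (intro sum_mono) auto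
  also have "\<dots> = n * (n + 2) * q"
    by (simp add: sum.distrib algebra_simps)
  also have "\<dots> \<le> n * (n + 2) * (3 * square_moment i j)"
    using off[of i j] dia[of i] assms square_moment_nonneg[of i j] by (intro mult_left_mono) (cases "i = j"; force)+
  finally show ?thesis by (simp add: algebra_simps)
qed

text \<open>Expanding the square of \<open>c \<bullet> Q w\<close>, the mixed terms vanish, and what is left is a sum of the
moments bounded in the previous lemma, with weights \<open>c\<^sub>j\<^sup>2\<close>.\<close>

lemma haar_fourth_moment_lower_bound:
  assumes c: "c \<in> carrier_vec n" and i: "i < n" and n: "n \<ge> 2"
  shows "(c \<bullet> c) * (u \<bullet> u) * (w \<bullet> w) / (3 * n * (n + 2))
    \<le> (\<integral>Q. ((Q *\<^sub>v u) $ i)\<^sup>2 * (c \<bullet> (Q *\<^sub>v w))\<^sup>2 \<partial>\<nu>)"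
proof -
  have ps: "prob_space \<nu>" by (rule haar_prob_space[OF haar])
  let ?X = "\<lambda>j l Q. (Q *\<^sub>v u) $ i * (Q *\<^sub>v u) $ i * (Q *\<^sub>v w) $ j * (Q *\<^sub>v w) $ l"
  have bm: "bounded_measurable \<nu> (\<lambda>Q. c $ j * c $ l * ?X j l Q)" if "j < n" "l < n" for j l
    using that i by (intro bounded_measurable_mult bounded_measurable_const bounded_measurable_coords)
  have "(c \<bullet> c) * (u \<bullet> u) * (w \<bullet> w) / (3 * n * (n + 2))
      = (\<Sum>j<n. c $ j * c $ j) * ((u \<bullet> u) * (w \<bullet> w) / (3 * n * (n + 2)))"
    using c by (simp add: scalar_prod_def[of c c] atLeast0LessThan)
  also have "\<dots> = (\<Sum>j<n. c $ j * c $ j * ((u \<bullet> u) * (w \<bullet> w) / (3 * n * (n + 2))))"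
    by (rule sum_distrib_right)
  also have "\<dots> \<le> (\<Sum>j<n. c $ j * c $ j * square_moment i j)"
  proof (intro sum_mono mult_left_mono)
    fix j assume "j \<in> {..<n}"
    with square_moment_lower_bound[of i j] i n
    show "(u \<bullet> u) * (w \<bullet> w) / (3 * n * (n + 2)) \<le> square_moment i j"
      by (subst pos_divide_le_eq) (auto simp: mult.commute intro: add_pos_nonneg)
  qed auto
  also have "\<dots> = (\<Sum>j<n. \<Sum>l<n. if j = l then c $ j * c $ j * square_moment i j else 0)"
    by simp
  also have "\<dots> = (\<Sum>j<n. \<Sum>l<n. (\<integral>Q. c $ j * c $ l * ?X j l Q \<partial>\<nu>))"
    using i by (intro sum.cong refl) (auto simp: square_moment_eq haar_fourth_moment_odd)
  also have "\<dots> = (\<Sum>j<n. (\<integral>Q. (\<Sum>l<n. c $ j * c $ l * ?X j l Q) \<partial>\<nu>))"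
    by (intro sum.cong refl Bochner_Integration.integral_sum[symmetric]
        bounded_measurable_integrable[OF ps] bm) auto
  also have "\<dots> = (\<integral>Q. (\<Sum>j<n. \<Sum>l<n. c $ j * c $ l * ?X j l Q) \<partial>\<nu>)"
    by (intro Bochner_Integration.integral_sum[symmetric]
        bounded_measurable_integrable[OF ps] bounded_measurable_sum bm) auto
  also have "\<dots> = (\<integral>Q. ((Q *\<^sub>v u) $ i)\<^sup>2 * (c \<bullet> (Q *\<^sub>v w))\<^sup>2 \<partial>\<nu>)"
  proof (rule Bochner_Integration.integral_cong[OF refl])
    fix Q assume Q: "Q \<in> space \<nu>"
    show "(\<Sum>j<n. \<Sum>l<n. c $ j * c $ l * ?X j l Q)
        = ((Q *\<^sub>v u) $ i)\<^sup>2 * (c \<bullet> (Q *\<^sub>v w))\<^sup>2"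
      unfolding square_scalar_prod[OF c image_carriers(2)[OF Q]] sum_distrib_left
      by (intro sum.cong refl) (simp add: power2_eq_square ac_simps)
  qed
  finally show ?thesis .
qed

end

section \<open>Norms of vectors\<close>

lemma self_scalar_prod_nonneg: "v \<bullet> v \<ge> 0" for v :: "real Matrix.vec"
  unfolding sum_sq_vec by (intro sum_nonneg) auto

lemma lp_norm_2_eq_sqrt: "lp_norm 2 v = sqrt (v \<bullet> v)"
proof -
  have "(\<Sum>i<dim_vec v. \<bar>v $ i\<bar> powr 2) = v \<bullet> v"
    unfolding sum_sq_vec by (intro sum.cong refl) (simp add: powr_numeral)
  then show ?thesis by (simp add: lp_norm_def powr_half_sqrt self_scalar_prod_nonneg)
qed

lemma lp_norm_2_square: "(lp_norm 2 v)\<^sup>2 = v \<bullet> v"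
  unfolding lp_norm_2_eq_sqrt by (rule real_sqrt_pow2[OF self_scalar_prod_nonneg])

lemma lp_norm_infty_eq: "lp_norm \<infinity> v = Max (insert 0 ((\<lambda>i. \<bar>v $ i\<bar>) ` {..<dim_vec v}))"
  by (simp add: lp_norm_def)

lemma abs_le_lp_norm_infty: "i < dim_vec v \<Longrightarrow> \<bar>v $ i\<bar> \<le> lp_norm \<infinity> v"
  unfolding lp_norm_def by (auto intro!: Max_ge)

lemma lp_norm_infty_nonneg: "lp_norm \<infinity> v \<ge> 0"
  unfolding lp_norm_def by (auto intro!: Max_ge)

lemma lp_norm_infty_square_le: "(lp_norm \<infinity> v)\<^sup>2 \<le> v \<bullet> v"
proof -
  have "lp_norm \<infinity> v \<in> insert 0 ((\<lambda>i. \<bar>v $ i\<bar>) ` {..<dim_vec v})"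
    unfolding lp_norm_infty_eq by (rule Max_in) auto
  then consider "lp_norm \<infinity> v = 0" | i where "i < dim_vec v" "lp_norm \<infinity> v = \<bar>v $ i\<bar>"
    by auto
  then show ?thesis
  proof cases
    case 1
    then show ?thesis by (simp add: self_scalar_prod_nonneg)
  next
    case 2
    then show ?thesis
      unfolding sum_sq_vec using member_le_sum[of i "{..<dim_vec v}" "\<lambda>i. (v $ i)\<^sup>2"] by simp
  qed
qed

lemma self_scalar_prod_le_lp_norms: "v \<bullet> v \<le> lp_norm \<infinity> v * lp_norm 1 v"
proof -
  have "v \<bullet> v = (\<Sum>i<dim_vec v. \<bar>v $ i\<bar> * \<bar>v $ i\<bar>)"
    unfolding sum_sq_vec by (simp add: power2_eq_square)
  also have "\<dots> \<le> (\<Sum>i<dim_vec v. lp_norm \<infinity> v * \<bar>v $ i\<bar>)"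
    by (intro sum_mono mult_right_mono abs_le_lp_norm_infty) auto
  also have "\<dots> = lp_norm \<infinity> v * lp_norm 1 v"
    by (simp add: lp_norm_def[of 1] sum_distrib_left sum_nonneg)
  finally show ?thesis .
qed

lemma lp_norm_nonneg: "lp_norm p v \<ge> 0"
  using lp_norm_infty_nonneg[of v] by (cases "p = \<infinity>") (auto simp: lp_norm_def)

lemma lp_norm_zero: "lp_norm p (0\<^sub>v n) = 0"
proof (cases "p = \<infinity>")
  case True
  have "insert 0 ((\<lambda>i. \<bar>0\<^sub>v n $ i :: real\<bar>) ` {..<n}) = {0}" by auto
  then have "Max (insert 0 ((\<lambda>i. \<bar>0\<^sub>v n $ i :: real\<bar>) ` {..<n})) = 0"
    by (simp only: Max_singleton)
  then show ?thesis using True by (simp only: lp_norm_infty_eq index_zero_vec(2))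
qed (simp add: lp_norm_def)

lemma op_norm_bounds:
  assumes M: "M \<in> carrier_mat n n"
    and K: "\<And>x. x \<in> carrier_vec n \<Longrightarrow> lp_norm p x \<le> 1 \<Longrightarrow> lp_norm p (M *\<^sub>v x) \<le> K"
  shows "0 \<le> op_norm p M" "op_norm p M \<le> K"
proof -
  let ?S = "{x \<in> carrier_vec n. lp_norm p x \<le> 1}"
  have op: "op_norm p M = (SUP x\<in>?S. lp_norm p (M *\<^sub>v x))"
    using M by (simp add: op_norm_def)
  have zero: "0\<^sub>v n \<in> ?S" by (simp add: lp_norm_zero)
  show "op_norm p M \<le> K"
    unfolding op
  proof (rule cSUP_least)
    show "?S \<noteq> {}" using zero by (metis empty_iff)
  qed (use K in auto)
  have "bdd_above ((\<lambda>x. lp_norm p (M *\<^sub>v x)) ` ?S)"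
    using K by (intro bdd_aboveI[of _ K]) auto
  then have "lp_norm p (M *\<^sub>v 0\<^sub>v n) \<le> op_norm p M"
    unfolding op using zero by (intro cSUP_upper)
  then show "0 \<le> op_norm p M"
    using lp_norm_nonneg[of p "M *\<^sub>v 0\<^sub>v n"] by linarith
qed

lemma op_norm_one_bounds: "0 \<le> op_norm p (1\<^sub>m n)" "op_norm p (1\<^sub>m n) \<le> 1"
  by (rule op_norm_bounds[of _ n]; simp)+

section \<open>Matrices with prescribed singular values and vectors\<close>

text \<open>A one-sided inverse of a square matrix is two-sided, hence equal to the computed one.\<close>

lemma minv_eqI:
  assumes A: "A \<in> carrier_mat n n" and X: "X \<in> carrier_mat n n" and AX: "A * X = 1\<^sub>m n"
  shows "invertible_mat A" "minv A = X"
proof -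
  have XA: "X * A = 1\<^sub>m n" by (rule mat_mult_left_right_inverse[OF A X AX])
  show "invertible_mat A"
    using A X AX XA unfolding invertible_mat_def inverts_mat_def by auto
  have "A \<in> Units (ring_mat TYPE(real) n ())"
    using A X AX XA by (auto simp: Units_def ring_mat_def)
  then obtain Y where Y: "mat_inverse A = Some Y"
    using mat_inverse(1)[OF A, of "()"] by (meson option.exhaust)
  from mat_inverse(2)[OF A Y] have Y': "Y * A = 1\<^sub>m n" "Y \<in> carrier_mat n n" by auto
  have "Y = Y * (A * X)" using Y' AX by simp
  also have "\<dots> = X" using Y' A X by (simp flip: assoc_mult_mat[of _ n n _ n _ n])
  finally show "minv A = X" by (simp add: minv_def Y)
qed

context
  fixes n :: nat and s t :: "real Matrix.vec"
  assumes s: "s \<in> carrier_vec n" and s_pos: "\<And>i. i < n \<Longrightarrow> s $ i > 0"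
  defines "t \<equiv> map_vec (\<lambda>x. 1 / x) s"
begin

lemma diag_recip_carrier: "diag t \<in> carrier_mat n n"
  using s by (simp add: diag_def t_def)

lemma diag_recip_mult_vec: "x \<in> carrier_vec n \<Longrightarrow> i < n \<Longrightarrow> (diag t *\<^sub>v x) $ i = t $ i * x $ i"
  using s by (simp add: diag_def t_def mat_diag_def scalar_prod_def if_distrib[of "\<lambda>a. a * _"] cong: if_cong)

lemma minv_svd:
  assumes R: "R \<in> orthogonal_mats n" and Q: "Q \<in> orthogonal_mats n"
  shows "invertible_mat (R * diag s * Q\<^sup>T)" "minv (R * diag s * Q\<^sup>T) = Q * diag t * R\<^sup>T"
proof -
  have car: "R \<in> carrier_mat n n" "Q \<in> carrier_mat n n" "R\<^sup>T \<in> carrier_mat n n" "Q\<^sup>T \<in> carrier_mat n n"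
      "diag s \<in> carrier_mat n n" "diag t \<in> carrier_mat n n"
    using orthogonal_mats_carrier[OF R] orthogonal_mats_carrier[OF Q] s
    by (auto simp: diag_def t_def)
  have st: "diag s * diag t = 1\<^sub>m n"
    using s by (simp add: diag_def t_def) 
      (auto simp: mat_diag_def s_pos less_imp_neq[OF s_pos, symmetric] intro!: eq_matI)
  note assoc = assoc_mult_mat[of _ n n _ n _ n]
  have "R * diag s * Q\<^sup>T * (Q * diag t * R\<^sup>T) = R * (diag s * ((Q\<^sup>T * Q) * diag t)) * R\<^sup>T"
    using car by (simp add: assoc)
  also have "\<dots> = 1\<^sub>m n"
    using Q car st orthogonal_mats_mult_transpose[OF R] by (simp add: orthogonal_mats_def)
  finally have "R * diag s * Q\<^sup>T * (Q * diag t * R\<^sup>T) = 1\<^sub>m n" .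
  then show "invertible_mat (R * diag s * Q\<^sup>T)" "minv (R * diag s * Q\<^sup>T) = Q * diag t * R\<^sup>T"
    using car by (intro minv_eqI[of _ n]; simp)+
qed

lemma svd_inverse_carrier:
  assumes "R \<in> orthogonal_mats n" "Q \<in> orthogonal_mats n"
  shows "Q * diag t * R\<^sup>T \<in> carrier_mat n n"
  using assms[THEN orthogonal_mats_carrier] diag_recip_carrier by auto

lemma svd_inverse_mult_vec:
  assumes "R \<in> orthogonal_mats n" "Q \<in> orthogonal_mats n" "x \<in> carrier_vec n"
  shows "(Q * diag t * R\<^sup>T) *\<^sub>v x = Q *\<^sub>v (diag t *\<^sub>v (R\<^sup>T *\<^sub>v x))"
proof -
  have "Q \<in> carrier_mat n n" "R\<^sup>T \<in> carrier_mat n n" "R\<^sup>T *\<^sub>v x \<in> carrier_vec n"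
    using assms(1,2)[THEN orthogonal_mats_carrier] assms(3) by (auto intro!: mult_mat_vec_carrier)
  then show ?thesis
    using assms(3) diag_recip_carrier
    by (simp add: assoc_mult_mat_vec[of _ n n _ n] mult_carrier_mat[of _ n n _ n])
qed

lemma scaled_carrier:
  assumes "R \<in> orthogonal_mats n" "x \<in> carrier_vec n"
  shows "R\<^sup>T *\<^sub>v x \<in> carrier_vec n" "diag t *\<^sub>v (R\<^sup>T *\<^sub>v x) \<in> carrier_vec n"
proof -
  have R: "R\<^sup>T \<in> carrier_mat n n" using orthogonal_mats_carrier[OF assms(1)] by simp
  show "R\<^sup>T *\<^sub>v x \<in> carrier_vec n" by (rule mult_mat_vec_carrier[OF R assms(2)])
  then show "diag t *\<^sub>v (R\<^sup>T *\<^sub>v x) \<in> carrier_vec n"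
    by (rule mult_mat_vec_carrier[OF diag_recip_carrier])
qed

lemma op_norm_svd_inverse:
  assumes R: "R \<in> orthogonal_mats n" and Q: "Q \<in> orthogonal_mats n"
  shows "0 \<le> op_norm 2 (Q * diag t * R\<^sup>T)" "op_norm 2 (Q * diag t * R\<^sup>T) \<le> lp_norm \<infinity> t"
proof -
  let ?m = "lp_norm \<infinity> t"
  have "lp_norm 2 ((Q * diag t * R\<^sup>T) *\<^sub>v x) \<le> ?m"
    if x: "x \<in> carrier_vec n" and le: "lp_norm 2 x \<le> 1" for x
  proof -
    define z where "z = R\<^sup>T *\<^sub>v x"
    have z: "z \<in> carrier_vec n" "diag t *\<^sub>v z \<in> carrier_vec n"
      using scaled_carrier[OF R x] by (simp_all add: z_def)
    have "(lp_norm 2 ((Q * diag t * R\<^sup>T) *\<^sub>v x))\<^sup>2 = (diag t *\<^sub>v z) \<bullet> (diag t *\<^sub>v z)"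
      unfolding lp_norm_2_square svd_inverse_mult_vec[OF R Q x] z_def[symmetric]
      by (rule orthogonal_mats_scalar_prod[OF Q z(2) z(2)])
    also have "\<dots> = (\<Sum>i<n. (t $ i)\<^sup>2 * (z $ i)\<^sup>2)"
      using z carrier_vecD[OF z(2)] unfolding sum_sq_vec[of "diag t *\<^sub>v z"]
      by (intro sum.cong) (simp_all add: diag_recip_mult_vec power_mult_distrib
          del: index_mult_mat_vec)
    also have "\<dots> \<le> (\<Sum>i<n. ?m\<^sup>2 * (z $ i)\<^sup>2)"
    proof (intro sum_mono mult_right_mono)
      fix i assume "i \<in> {..<n}"
      then have "\<bar>t $ i\<bar> \<le> ?m" using s by (intro abs_le_lp_norm_infty) (simp add: t_def)
      then show "(t $ i)\<^sup>2 \<le> ?m\<^sup>2" by (metis abs_ge_zero power2_abs power_mono)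
    qed auto
    also have "\<dots> = ?m\<^sup>2 * (z \<bullet> z)"
      using z by (simp add: sum_sq_vec sum_distrib_left)
    also have "z \<bullet> z = x \<bullet> x"
      unfolding z_def by (rule orthogonal_mats_scalar_prod[OF orthogonal_mats_transpose[OF R] x x])
    also have "?m\<^sup>2 * (x \<bullet> x) \<le> ?m\<^sup>2 * 1"
      using le lp_norm_nonneg[of 2 x] unfolding lp_norm_2_square[symmetric]
      by (intro mult_left_mono power_le_one) auto
    finally show ?thesis
      using power2_le_imp_le[OF _ lp_norm_infty_nonneg] by (metis mult.right_neutral)
  qed
  from op_norm_bounds[OF svd_inverse_carrier[OF R Q] this]
  show "0 \<le> op_norm 2 (Q * diag t * R\<^sup>T)" "op_norm 2 (Q * diag t * R\<^sup>T) \<le> lp_norm \<infinity> t" by auto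
qed

text \<open>The entries of \<open>A\<^sup>-\<^sup>T c\<close> are rewritten by duality as \<open>c \<bullet> A\<^sup>-\<^sup>1 e\<close> with unit vectors \<open>e\<close>. In this
form \<open>Q\<close> acts from the left on vectors that depend on \<open>R\<close> only, which is what the moment bounds
for \<open>Q\<close> require.\<close>

lemma sensitivity_svd:
  assumes R: "R \<in> orthogonal_mats n" and Q: "Q \<in> orthogonal_mats n"
    and b: "b \<in> carrier_vec n" and c: "c \<in> carrier_vec n"
  shows "sensitivity c (R * diag s * Q\<^sup>T, 1\<^sub>m n, b) =
    (\<Sum>i<n. ((Q *\<^sub>v (diag t *\<^sub>v (R\<^sup>T *\<^sub>v b))) $ i)\<^sup>2
      * (c \<bullet> (Q *\<^sub>v (diag t *\<^sub>v (R\<^sup>T *\<^sub>v unit_vec n i))))\<^sup>2)"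
proof -
  let ?X = "Q * diag t * R\<^sup>T"
  have X: "?X \<in> carrier_mat n n" by (rule svd_inverse_carrier[OF R Q])
  have Xb: "?X *\<^sub>v b \<in> carrier_vec n" and Xc: "?X\<^sup>T *\<^sub>v c \<in> carrier_vec n"
    using X b c by (auto intro!: mult_mat_vec_carrier)
  define y where "y = (?X *\<^sub>v b) \<odot> (?X\<^sup>T *\<^sub>v c)"
  have y: "y \<in> carrier_vec n" and y_nth: "\<And>i. i < n \<Longrightarrow> y $ i = (?X *\<^sub>v b) $ i * (?X\<^sup>T *\<^sub>v c) $ i"
    using carrier_vecD[OF Xb] unfolding y_def hprod_def by auto
  have "(?X\<^sup>T *\<^sub>v c) $ i = c \<bullet> (?X *\<^sub>v unit_vec n i)" if "i < n" for i
  proof -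
    have "(?X\<^sup>T *\<^sub>v c) $ i = (?X\<^sup>T *\<^sub>v c) \<bullet> unit_vec n i" using that by simp
    also have "\<dots> = c \<bullet> (?X *\<^sub>v unit_vec n i)"
      by (rule transpose_vec_mult_scalar[OF X _ c]) simp
    finally show ?thesis .
  qed
  then have "y \<bullet> y = (\<Sum>i<n. ((?X *\<^sub>v b) $ i)\<^sup>2 * (c \<bullet> (?X *\<^sub>v unit_vec n i))\<^sup>2)"
    using carrier_vecD[OF y] unfolding sum_sq_vec[of y]
    by (intro sum.cong) (simp_all add: y_nth power_mult_distrib)
  moreover have "sensitivity c (R * diag s * Q\<^sup>T, 1\<^sub>m n, b) = y \<bullet> y"
    unfolding sensitivity_def prod.case minv_svd(2)[OF R Q] y_def[symmetric]
      transpose_one one_mult_mat_vec[OF y] lp_norm_2_square ..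
  ultimately show ?thesis
    using svd_inverse_mult_vec[OF R Q b] svd_inverse_mult_vec[OF R Q unit_vec_carrier] by simp
qed

lemma response_svd:
  assumes R: "R \<in> orthogonal_mats n" and Q: "Q \<in> orthogonal_mats n" and b: "b \<in> carrier_vec n"
  shows "response c (R * diag s * Q\<^sup>T, B, b) = c \<bullet> (Q *\<^sub>v (diag t *\<^sub>v (R\<^sup>T *\<^sub>v b)))"
  unfolding response_def using minv_svd(2)[OF R Q] svd_inverse_mult_vec[OF R Q b] by simp

lemma scaled_norm_eq:
  assumes R: "R \<in> orthogonal_mats n" and x: "x \<in> carrier_vec n"
  shows "(diag t *\<^sub>v (R\<^sup>T *\<^sub>v x)) \<bullet> (diag t *\<^sub>v (R\<^sup>T *\<^sub>v x))
    = (\<Sum>k<n. (t $ k)\<^sup>2 * (x \<bullet> (R *\<^sub>v unit_vec n k))\<^sup>2)"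
proof -
  have Rc: "R \<in> carrier_mat n n" by (rule orthogonal_mats_carrier[OF R])
  have "(R\<^sup>T *\<^sub>v x) $ k = x \<bullet> (R *\<^sub>v unit_vec n k)" if "k < n" for k
    using transpose_vec_mult_scalar[OF Rc _ x, of "unit_vec n k"] that by simp
  then show ?thesis
    using carrier_vecD[OF scaled_carrier(2)[OF R x]] scaled_carrier(1)[OF R x]
    unfolding sum_sq_vec[of "diag t *\<^sub>v (R\<^sup>T *\<^sub>v x)"]
    by (intro sum.cong) (simp_all add: diag_recip_mult_vec power_mult_distrib
        del: index_mult_mat_vec)
qed

text \<open>The sum is the squared Frobenius norm of \<open>T R\<^sup>T\<close>, which an orthogonal factor does not change. As the
identity holds for every \<open>R\<close>, the average over \<open>R\<close> reduces to a second moment.\<close>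

lemma sum_scaled_norm_unit_vec:
  assumes R: "R \<in> orthogonal_mats n"
  shows "(\<Sum>i<n. (diag t *\<^sub>v (R\<^sup>T *\<^sub>v unit_vec n i)) \<bullet> (diag t *\<^sub>v (R\<^sup>T *\<^sub>v unit_vec n i))) = t \<bullet> t"
proof -
  have Rc: "R \<in> carrier_mat n n" by (rule orthogonal_mats_carrier[OF R])
  have "(\<Sum>i<n. (diag t *\<^sub>v (R\<^sup>T *\<^sub>v unit_vec n i)) \<bullet> (diag t *\<^sub>v (R\<^sup>T *\<^sub>v unit_vec n i)))
      = (\<Sum>i<n. \<Sum>k<n. (t $ k)\<^sup>2 * ((R *\<^sub>v unit_vec n k) $ i)\<^sup>2)"
    using Rc by (intro sum.cong refl) (simp add: scaled_norm_eq[OF R])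
  also have "\<dots> = (\<Sum>k<n. (t $ k)\<^sup>2 * (\<Sum>i<n. ((R *\<^sub>v unit_vec n k) $ i)\<^sup>2))"
    by (subst sum.swap) (simp add: sum_distrib_left)
  also have "\<dots> = (\<Sum>k<n. (t $ k)\<^sup>2)"
  proof (intro sum.cong refl)
    fix k assume "k \<in> {..<n}"
    then have "(\<Sum>i<n. ((R *\<^sub>v unit_vec n k) $ i)\<^sup>2) = 1"
      using orthogonal_mats_scalar_prod[OF R, of "unit_vec n k" "unit_vec n k"] 
        sum_sq_vec[of "R *\<^sub>v unit_vec n k"] Rc by simp
    then show "(t $ k)\<^sup>2 * (\<Sum>i<n. ((R *\<^sub>v unit_vec n k) $ i)\<^sup>2) = (t $ k)\<^sup>2" by simp
  qed
  also have "\<dots> = t \<bullet> t" using s by (simp add: sum_sq_vec t_def)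
  finally show ?thesis .
qed

text \<open>Reduces to second moments of the columns of \<open>R\<close>, one for each singular value.\<close>

lemma haar_scaled_norm:
  assumes haar: "is_haar_orthogonal n \<nu>" and x: "x \<in> carrier_vec n"
  shows "(\<integral>R. (diag t *\<^sub>v (R\<^sup>T *\<^sub>v x)) \<bullet> (diag t *\<^sub>v (R\<^sup>T *\<^sub>v x)) \<partial>\<nu>) = (t \<bullet> t) * (x \<bullet> x) / n"
proof -
  have ps: "prob_space \<nu>" by (rule haar_prob_space[OF haar])
  have "(\<integral>R. (diag t *\<^sub>v (R\<^sup>T *\<^sub>v x)) \<bullet> (diag t *\<^sub>v (R\<^sup>T *\<^sub>v x)) \<partial>\<nu>)
      = (\<integral>R. (\<Sum>k<n. (t $ k)\<^sup>2 * (x \<bullet> (R *\<^sub>v unit_vec n k))\<^sup>2) \<partial>\<nu>)"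
    using haar_space[OF haar] x
    by (intro Bochner_Integration.integral_cong refl scaled_norm_eq) auto
  also have "\<dots> = (\<Sum>k<n. (\<integral>R. (t $ k)\<^sup>2 * (x \<bullet> (R *\<^sub>v unit_vec n k))\<^sup>2 \<partial>\<nu>))"
    using bounded_measurable_haar[OF haar] x
    by (intro Bochner_Integration.integral_sum bounded_measurable_integrable[OF ps]
        bounded_measurable_mult bounded_measurable_const bounded_measurable_power2
        bounded_measurable_scalar_prod[of _ n] bounded_measurable_vec_const
        bounded_measurable_mult_mat_vec) auto
  also have "\<dots> = (\<Sum>k<n. (t $ k)\<^sup>2 * ((x \<bullet> x) / n))"
    using x by (intro sum.cong refl) (simp add: haar_second_moment[OF haar unit_vec_carrier])
  also have "\<dots> = (t \<bullet> t) * (x \<bullet> x) / n"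
    using s unfolding sum_distrib_right[symmetric] sum_sq_vec[of t] by (simp add: t_def)
  finally show ?thesis .
qed

end

section \<open>Averages over two independent Haar factors\<close>

lemma indep_expectation_Fubini:
  fixes h :: "real Matrix.mat \<Rightarrow> real Matrix.mat \<Rightarrow> real"
  assumes M: "prob_space M"
    and indep: "prob_space.indep_var M (borel_orthogonal n) R (borel_orthogonal n) Q"
    and h: "bounded_measurable (borel_orthogonal n \<Otimes>\<^sub>M borel_orthogonal n) (\<lambda>p. h (fst p) (snd p))"
  shows "integrable M (\<lambda>\<omega>. h (R \<omega>) (Q \<omega>))"
    and "integrable (distr M (borel_orthogonal n) R)
      (\<lambda>r. \<integral>q. h r q \<partial>distr M (borel_orthogonal n) Q)"
    and "(\<integral>\<omega>. h (R \<omega>) (Q \<omega>) \<partial>M) =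
      (\<integral>r. (\<integral>q. h r q \<partial>distr M (borel_orthogonal n) Q) \<partial>distr M (borel_orthogonal n) R)"
proof -
  interpret prob_space M by fact
  let ?BO = "borel_orthogonal n"
  let ?\<rho> = "distr M ?BO R" and ?\<kappa> = "distr M ?BO Q"
  have R: "R \<in> measurable M ?BO" and Q: "Q \<in> measurable M ?BO"
    and D: "?\<rho> \<Otimes>\<^sub>M ?\<kappa> = distr M (?BO \<Otimes>\<^sub>M ?BO) (\<lambda>\<omega>. (R \<omega>, Q \<omega>))"
    using indep unfolding indep_var_distribution_eq by auto
  have RQ: "(\<lambda>\<omega>. (R \<omega>, Q \<omega>)) \<in> measurable M (?BO \<Otimes>\<^sub>M ?BO)"
    using R Q by (rule measurable_Pair)
  have hm: "(\<lambda>p. h (fst p) (snd p)) \<in> borel_measurable (?BO \<Otimes>\<^sub>M ?BO)"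
    by (rule bounded_measurable_measurable[OF h])
  show "integrable M (\<lambda>\<omega>. h (R \<omega>) (Q \<omega>))"
    using bounded_measurable_integrable[OF M bounded_measurable_compose[OF h RQ]] by simp
  then have int: "integrable (?\<rho> \<Otimes>\<^sub>M ?\<kappa>) (\<lambda>(r, q). h r q)"
    unfolding D using integrable_distr_eq[OF RQ hm] by (simp add: case_prod_beta')
  interpret \<rho>: prob_space ?\<rho> by (rule prob_space_distr[OF R])
  interpret \<kappa>: prob_space ?\<kappa> by (rule prob_space_distr[OF Q])
  interpret P: pair_sigma_finite ?\<rho> ?\<kappa> ..
  show "integrable ?\<rho> (\<lambda>r. \<integral>q. h r q \<partial>?\<kappa>)"
    using P.integrable_fst'[OF int] by simp
  have "(\<integral>r. (\<integral>q. h r q \<partial>?\<kappa>) \<partial>?\<rho>) = (\<integral>p. (case p of (r, q) \<Rightarrow> h r q) \<partial>(?\<rho> \<Otimes>\<^sub>M ?\<kappa>))"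
    by (rule P.integral_fst'[OF int, simplified])
  also have "\<dots> = (\<integral>\<omega>. h (R \<omega>) (Q \<omega>) \<partial>M)"
    unfolding D using integral_distr[OF RQ hm] by (simp add: case_prod_beta')
  finally show "(\<integral>\<omega>. h (R \<omega>) (Q \<omega>) \<partial>M) = (\<integral>r. (\<integral>q. h r q \<partial>?\<kappa>) \<partial>?\<rho>)" ..
qed

lemma orthogonal_factors:
  assumes "prob_space M"
    and "prob_space.indep_var M (borel_orthogonal n) R (borel_orthogonal n) Q"
    and "\<omega> \<in> space M"
  shows "R \<omega> \<in> orthogonal_mats n" "Q \<omega> \<in> orthogonal_mats n"
  using assms measurable_space[of R M "borel_orthogonal n"]
    measurable_space[of Q M "borel_orthogonal n"]
  by (auto simp: prob_space.indep_var_distribution_eq)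

context
  fixes n :: nat and b c s t :: "real Matrix.vec"
    and M :: "'w measure" and R Q :: "'w \<Rightarrow> real Matrix.mat"
  assumes b: "b \<in> carrier_vec n" and c: "c \<in> carrier_vec n"
    and s: "s \<in> carrier_vec n" and s_pos: "\<And>i. i < n \<Longrightarrow> s $ i > 0"
    and M: "prob_space M"
    and indep: "prob_space.indep_var M (borel_orthogonal n) R (borel_orthogonal n) Q"
    and haar_R: "is_haar_orthogonal n (distr M (borel_orthogonal n) R)"
    and haar_Q: "is_haar_orthogonal n (distr M (borel_orthogonal n) Q)"
  defines "t \<equiv> map_vec (\<lambda>x. 1 / x) s"
begin

lemma recip_carrier: "t \<in> carrier_vec n" "diag t \<in> carrier_mat n n"
  using s by (simp_all add: t_def diag_def)

lemma bounded_measurable_solution: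
  assumes "x \<in> carrier_vec n"
  shows "bounded_measurable_vec (borel_orthogonal n \<Otimes>\<^sub>M borel_orthogonal n) n
    (\<lambda>p. snd p *\<^sub>v (diag t *\<^sub>v ((fst p)\<^sup>T *\<^sub>v x)))"
  using assms recip_carrier
  by (intro bounded_measurable_mult_mat_vec bounded_measurable_mat_transpose
      bounded_measurable_mat_const bounded_measurable_vec_const
      bounded_measurable_mat_compose[OF bounded_measurable_orthogonal] measurable_fst measurable_snd)

text \<open>Both averages are exact second moments, so the second moment of the response is an identity.\<close>

lemma expected_response:
  defines "\<phi> \<equiv> \<lambda>\<omega>. (R \<omega> * diag s * (Q \<omega>)\<^sup>T, 1\<^sub>m n, b)"
  shows "integrable M (\<lambda>\<omega>. \<bar>response c (\<phi> \<omega>)\<bar>\<^sup>2)"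
    and "(\<integral>\<omega>. \<bar>response c (\<phi> \<omega>)\<bar>\<^sup>2 \<partial>M) = (c \<bullet> c) * (b \<bullet> b) * (t \<bullet> t) / (real n)\<^sup>2"
proof -
  let ?h = "\<lambda>r q. (c \<bullet> (q *\<^sub>v (diag t *\<^sub>v (r\<^sup>T *\<^sub>v b))))\<^sup>2"
  let ?\<rho> = "distr M (borel_orthogonal n) R" and ?\<kappa> = "distr M (borel_orthogonal n) Q"
  have eq: "\<bar>response c (\<phi> \<omega>)\<bar>\<^sup>2 = ?h (R \<omega>) (Q \<omega>)" if "\<omega> \<in> space M" for \<omega>
    using response_svd[OF s s_pos orthogonal_factors[OF M indep that] b] unfolding \<phi>_def t_def by simp
  have bm: "bounded_measurable (borel_orthogonal n \<Otimes>\<^sub>M borel_orthogonal n) (\<lambda>p. ?h (fst p) (snd p))"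
    by (intro bounded_measurable_power2 bounded_measurable_scalar_prod[of _ n]
        bounded_measurable_vec_const c bounded_measurable_solution b)
  note F = indep_expectation_Fubini[OF M indep bm]
  show "integrable M (\<lambda>\<omega>. \<bar>response c (\<phi> \<omega>)\<bar>\<^sup>2)"
    by (rule iffD2[OF Bochner_Integration.integrable_cong[OF refl eq] F(1)])
  have "(\<integral>\<omega>. \<bar>response c (\<phi> \<omega>)\<bar>\<^sup>2 \<partial>M) = (\<integral>\<omega>. ?h (R \<omega>) (Q \<omega>) \<partial>M)"
    by (rule Bochner_Integration.integral_cong[OF refl eq])
  also have "\<dots> = (\<integral>r. (\<integral>q. ?h r q \<partial>?\<kappa>) \<partial>?\<rho>)" by (rule F(3))
  also have "\<dots> = (\<integral>r. (c \<bullet> c) / n * ((diag t *\<^sub>v (r\<^sup>T *\<^sub>v b)) \<bullet> (diag t *\<^sub>v (r\<^sup>T *\<^sub>v b))) \<partial>?\<rho>)"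
  proof (rule Bochner_Integration.integral_cong[OF refl])
    fix r assume "r \<in> space ?\<rho>"
    then have r: "r \<in> orthogonal_mats n" by simp
    show "(\<integral>q. ?h r q \<partial>?\<kappa>)
        = (c \<bullet> c) / n * ((diag t *\<^sub>v (r\<^sup>T *\<^sub>v b)) \<bullet> (diag t *\<^sub>v (r\<^sup>T *\<^sub>v b)))"
      using haar_second_moment[OF haar_Q scaled_carrier(2)[OF s s_pos r b] c]
      unfolding t_def by simp
  qed
  also have "\<dots> = (c \<bullet> c) / n * ((t \<bullet> t) * (b \<bullet> b) / n)"
    using haar_scaled_norm[OF s s_pos haar_R b] unfolding t_def by simp
  finally show "(\<integral>\<omega>. \<bar>response c (\<phi> \<omega>)\<bar>\<^sup>2 \<partial>M) = (c \<bullet> c) * (b \<bullet> b) * (t \<bullet> t) / (real n)\<^sup>2"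
    by (simp add: power2_eq_square ac_simps)
qed

text \<open>For fixed \<open>R\<close>, the average over \<open>Q\<close> is bounded below term by term; the sum over \<open>i\<close> then collapses
to \<open>|t|\<^sup>2\<close>, which leaves a constant multiple of \<open>|T R\<^sup>T b|\<^sup>2\<close> to be averaged over \<open>R\<close>.\<close>

lemma expected_sensitivity:
  defines "\<phi> \<equiv> \<lambda>\<omega>. (R \<omega> * diag s * (Q \<omega>)\<^sup>T, 1\<^sub>m n, b)"
  shows "integrable M (\<lambda>\<omega>. sensitivity c (\<phi> \<omega>))"
    and "n \<ge> 2 \<Longrightarrow> (c \<bullet> c) * (b \<bullet> b) * (t \<bullet> t)\<^sup>2 / (3 * (real n)\<^sup>2 * (real n + 2))
      \<le> (\<integral>\<omega>. sensitivity c (\<phi> \<omega>) \<partial>M)"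
proof -
  let ?u = "\<lambda>r x. diag t *\<^sub>v (r\<^sup>T *\<^sub>v x)"
  let ?g = "\<lambda>i r q. ((q *\<^sub>v ?u r b) $ i)\<^sup>2 * (c \<bullet> (q *\<^sub>v ?u r (unit_vec n i)))\<^sup>2"
  let ?h = "\<lambda>r q. \<Sum>i<n. ?g i r q"
  let ?\<rho> = "distr M (borel_orthogonal n) R" and ?\<kappa> = "distr M (borel_orthogonal n) Q"
  let ?BO = "borel_orthogonal n"
  have eq: "sensitivity c (\<phi> \<omega>) = ?h (R \<omega>) (Q \<omega>)" if "\<omega> \<in> space M" for \<omega>
    using sensitivity_svd[OF s s_pos orthogonal_factors[OF M indep that] b c] unfolding \<phi>_def t_def .
  have bm: "bounded_measurable (?BO \<Otimes>\<^sub>M ?BO) (\<lambda>p. ?g i (fst p) (snd p))" if "i < n" for i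
    using that
    by (intro bounded_measurable_mult bounded_measurable_power2 bounded_measurable_scalar_prod[of _ n]
        bounded_measurable_vec_index[of _ n] bounded_measurable_vec_const c
        bounded_measurable_solution b unit_vec_carrier)
  then have bm_sum: "bounded_measurable (?BO \<Otimes>\<^sub>M ?BO) (\<lambda>p. ?h (fst p) (snd p))"
    by (intro bounded_measurable_sum) auto
  note F = indep_expectation_Fubini[OF M indep bm_sum]
  show "integrable M (\<lambda>\<omega>. sensitivity c (\<phi> \<omega>))"
    by (rule iffD2[OF Bochner_Integration.integrable_cong[OF refl eq] F(1)])
  assume n: "n \<ge> 2"
  define K where "K = (c \<bullet> c) * (t \<bullet> t) / (3 * n * (n + 2))"
  have section_bm: "bounded_measurable ?\<kappa> (?g i r)" if "i < n" "r \<in> orthogonal_mats n" for i r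
  proof -
    have "bounded_measurable ?BO (\<lambda>q. ?g i (fst (r, q)) (snd (r, q)))"
      using that
      by (intro bounded_measurable_compose[OF bm, where T = "\<lambda>q. (r, q)"] measurable_Pair1') auto
    then show ?thesis unfolding bounded_measurable_def by simp
  qed
  have inner: "K * (?u r b \<bullet> ?u r b) \<le> (\<integral>q. ?h r q \<partial>?\<kappa>)" if r: "r \<in> orthogonal_mats n" for r
  proof -
    have "K * (?u r b \<bullet> ?u r b) = (\<Sum>i<n. (c \<bullet> c) * (?u r b \<bullet> ?u r b)
        * (?u r (unit_vec n i) \<bullet> ?u r (unit_vec n i)) / (3 * n * (n + 2)))"
      unfolding K_def sum_divide_distrib[symmetric] sum_distrib_left[symmetric]
      using sum_scaled_norm_unit_vec[OF s s_pos r] unfolding t_def by (simp add: ac_simps)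
    also have "\<dots> \<le> (\<Sum>i<n. (\<integral>q. ?g i r q \<partial>?\<kappa>))"
    proof (intro sum_mono)
      fix i assume "i \<in> {..<n}"
      then show "(c \<bullet> c) * (?u r b \<bullet> ?u r b) * (?u r (unit_vec n i) \<bullet> ?u r (unit_vec n i))
          / (3 * n * (n + 2)) \<le> (\<integral>q. ?g i r q \<partial>?\<kappa>)"
        using haar_fourth_moment_lower_bound[OF haar_Q scaled_carrier(2)[OF s s_pos r b]
            scaled_carrier(2)[OF s s_pos r unit_vec_carrier] c _ n]
        unfolding t_def by simp
    qed
    also have "\<dots> = (\<integral>q. ?h r q \<partial>?\<kappa>)"
      using section_bm r
      by (intro Bochner_Integration.integral_sum[symmetric]
          bounded_measurable_integrable[OF haar_prob_space[OF haar_Q]]) auto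
    finally show ?thesis .
  qed
  have "(c \<bullet> c) * (b \<bullet> b) * (t \<bullet> t)\<^sup>2 / (3 * (real n)\<^sup>2 * (real n + 2)) = K * ((t \<bullet> t) * (b \<bullet> b) / n)"
    unfolding K_def by (simp add: power2_eq_square ac_simps)
  also have "\<dots> = (\<integral>r. K * (?u r b \<bullet> ?u r b) \<partial>?\<rho>)"
    using haar_scaled_norm[OF s s_pos haar_R b] unfolding t_def by simp
  also have "\<dots> \<le> (\<integral>r. (\<integral>q. ?h r q \<partial>?\<kappa>) \<partial>?\<rho>)"
  proof (rule integral_mono)
    show "integrable ?\<rho> (\<lambda>r. K * (?u r b \<bullet> ?u r b))"
      using bounded_measurable_haar[OF haar_R] recip_carrier b
      by (intro bounded_measurable_integrable[OF haar_prob_space[OF haar_R]]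
          bounded_measurable_mult bounded_measurable_const bounded_measurable_scalar_prod[of _ n]
          bounded_measurable_mult_mat_vec bounded_measurable_mat_transpose
          bounded_measurable_mat_const bounded_measurable_vec_const)
    show "integrable ?\<rho> (\<lambda>r. \<integral>q. ?h r q \<partial>?\<kappa>)"
      by (rule F(2))
  qed (use inner in simp)
  also have "\<dots> = (\<integral>\<omega>. ?h (R \<omega>) (Q \<omega>) \<partial>M)" by (rule F(3)[symmetric])
  also have "\<dots> = (\<integral>\<omega>. sensitivity c (\<phi> \<omega>) \<partial>M)"
    by (rule Bochner_Integration.integral_cong[OF refl eq[symmetric]])
  finally show "(c \<bullet> c) * (b \<bullet> b) * (t \<bullet> t)\<^sup>2 / (3 * (real n)\<^sup>2 * (real n + 2))
      \<le> (\<integral>\<omega>. sensitivity c (\<phi> \<omega>) \<partial>M)" .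
qed

end

section \<open>Growth rates\<close>

lemma eventually_bounds_of_bigtheta:
  assumes "f \<in> \<Theta>(g)"
  obtains k K where "k > 0" "K > 0"
    "\<forall>\<^sub>F n in sequentially. k * \<bar>g n\<bar> \<le> \<bar>f n :: real\<bar>"
    "\<forall>\<^sub>F n in sequentially. \<bar>f n\<bar> \<le> K * \<bar>g n\<bar>"
proof -
  obtain K where K: "K > 0" "\<forall>\<^sub>F n in sequentially. \<bar>f n\<bar> \<le> K * \<bar>g n\<bar>"
    using landau_o.bigE[OF bigthetaD1[OF assms]] by auto
  obtain k where k: "k > 0" "\<forall>\<^sub>F n in sequentially. \<bar>f n\<bar> \<ge> k * \<bar>g n\<bar>"
    using landau_omega.bigE[OF bigthetaD2[OF assms]] by auto
  show ?thesis by (rule that[OF k(1) K(1) k(2) K(2)])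
qed

lemma self_scalar_prod_bounded_of_lp_norms:
  fixes v :: "nat \<Rightarrow> real Matrix.vec"
  assumes "(\<lambda>n. lp_norm \<infinity> (v n)) \<in> \<Theta>(\<lambda>_. 1)" and "(\<lambda>n. lp_norm 1 (v n)) \<in> \<Theta>(\<lambda>_. 1)"
  obtains k K where "k > 0" "K > 0" "\<forall>\<^sub>F n in sequentially. k \<le> v n \<bullet> v n \<and> v n \<bullet> v n \<le> K"
proof -
  obtain k K where kK: "k > 0" "K > 0" "\<forall>\<^sub>F n in sequentially. k * \<bar>1\<bar> \<le> \<bar>lp_norm \<infinity> (v n)\<bar>"
      "\<forall>\<^sub>F n in sequentially. \<bar>lp_norm \<infinity> (v n)\<bar> \<le> K * \<bar>1\<bar>"
    by (rule eventually_bounds_of_bigtheta[OF assms(1)])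
  obtain K' where K': "K' > 0" "\<forall>\<^sub>F n in sequentially. \<bar>lp_norm 1 (v n)\<bar> \<le> K'"
    using landau_o.bigE[OF bigthetaD1[OF assms(2)]] by auto
  have "\<forall>\<^sub>F n in sequentially. k\<^sup>2 \<le> v n \<bullet> v n \<and> v n \<bullet> v n \<le> K * K'"
    using kK(3,4) K'(2)
  proof eventually_elim
    case (elim n)
    have "k\<^sup>2 \<le> (lp_norm \<infinity> (v n))\<^sup>2"
      using elim(1) kK(1) by (intro power_mono) (simp_all add: lp_norm_infty_nonneg)
    moreover have "lp_norm \<infinity> (v n) * lp_norm 1 (v n) \<le> K * K'"
      using elim(2,3) kK(2) lp_norm_nonneg[of 1 "v n"] by (intro mult_mono) auto
    ultimately show ?case
      using lp_norm_infty_square_le[of "v n"] self_scalar_prod_le_lp_norms[of "v n"] by linarith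
  qed
  then show ?thesis
    using that[of "k\<^sup>2" "K * K'"] kK(1,2) K'(1) by simp
qed

theorem proposition2:
  fixes f :: "real \<Rightarrow> real" and L \<mu> \<gamma> :: real
    and b c s :: "nat \<Rightarrow> real Matrix.vec"
    and M :: "'w measure"
    and R Q A :: "nat \<Rightarrow> 'w \<Rightarrow> real Matrix.mat"
    and B :: "nat \<Rightarrow> real Matrix.mat"
    and \<phi> :: "nat \<Rightarrow> 'w \<Rightarrow> physical_system"
  assumes "lipschitz_smooth L f" and "strongly_convex \<mu> f" and "bdd_below (range f)"
    and "\<gamma> \<ge> 1 / 2"
    and "\<And>n. n \<ge> 1 \<Longrightarrow> b n \<in> carrier_vec n"
    and "\<And>n. n \<ge> 1 \<Longrightarrow> c n \<in> carrier_vec n"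
    and "(\<lambda>n. lp_norm \<infinity> (b n)) \<in> \<Theta>(\<lambda>_. 1)" and "(\<lambda>n. lp_norm 1 (b n)) \<in> \<Theta>(\<lambda>_. 1)"
    and "(\<lambda>n. lp_norm \<infinity> (c n)) \<in> \<Theta>(\<lambda>_. 1)" and "(\<lambda>n. lp_norm 1 (c n)) \<in> \<Theta>(\<lambda>_. 1)"
    and "\<And>n. n \<ge> 1 \<Longrightarrow> s n \<in> carrier_vec n"
    and "\<And>n i. n \<ge> 1 \<Longrightarrow> i < n \<Longrightarrow> s n $ i > 0"
    and "(\<lambda>n. lp_norm \<infinity> (map_vec (\<lambda>x. 1 / x) (s n))) \<in> O(\<lambda>n. real n powr \<gamma>)"
    and "(\<lambda>n. lp_norm 2 (map_vec (\<lambda>x. 1 / x) (s n))) \<in> \<Theta>(\<lambda>n. real n)"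
    and "prob_space M"
    and "\<And>n. n \<ge> 1 \<Longrightarrow>
           prob_space.indep_var M (borel_orthogonal n) (R n) (borel_orthogonal n) (Q n)"
    and "\<And>n. n \<ge> 1 \<Longrightarrow> is_haar_orthogonal n (distr M (borel_orthogonal n) (R n))"
    and "\<And>n. n \<ge> 1 \<Longrightarrow> is_haar_orthogonal n (distr M (borel_orthogonal n) (Q n))"
    and "\<And>n \<omega>. A n \<omega> = R n \<omega> * diag (s n) * (Q n \<omega>)\<^sup>T"
    and "\<And>n. B n = 1\<^sub>m n"
    and "\<And>n \<omega>. \<phi> n \<omega> = (A n \<omega>, B n, b n)"
  shows
    "(\<forall>n\<ge>1. \<forall>\<omega>\<in>space M. invertible_mat (A n \<omega>)) \<and>
     (\<exists>C>0. \<forall>\<^sub>F n in sequentially. \<forall>\<omega>\<in>space M. op_norm 2 (minv (A n \<omega>)) \<le> C * real n powr \<gamma>) \<and>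
     (\<lambda>n. \<integral>\<omega>. (lp_norm 2 ((B n)\<^sup>T *\<^sub>v
                   ((minv (A n \<omega>) *\<^sub>v b n) \<odot> ((minv (A n \<omega>))\<^sup>T *\<^sub>v c n))))\<^sup>2 \<partial>M)
       \<in> \<Omega>(\<lambda>n. real n) \<and>
     (\<lambda>n. \<integral>\<omega>. \<bar>c n \<bullet> (minv (A n \<omega>) *\<^sub>v b n)\<bar>\<^sup>2 \<partial>M) \<in> O(\<lambda>_. 1) \<and>
     asymptotic_convergence_conditions_on_average M L \<mu> (1 - \<gamma>) \<gamma> f c \<phi>"
proof -
  note b = assms(5) and c = assms(6) and s = assms(11) and s_pos = assms(12)
    and M = assms(15) and indep = assms(16) and haar_R = assms(17) and haar_Q = assms(18)
  define t where "t = (\<lambda>n. map_vec (\<lambda>x. 1 / x) (s n))"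
  have t: "t n = map_vec (\<lambda>x. 1 / x) (s n)" for n by (simp add: t_def)
  have A: "A n \<omega> = R n \<omega> * diag (s n) * (Q n \<omega>)\<^sup>T"
    and \<phi>: "\<phi> n \<omega> = (R n \<omega> * diag (s n) * (Q n \<omega>)\<^sup>T, 1\<^sub>m n, b n)" for n \<omega>
    using assms(19-21) by simp_all
  have RQ: "R n \<omega> \<in> orthogonal_mats n" "Q n \<omega> \<in> orthogonal_mats n" if "n \<ge> 1" "\<omega> \<in> space M" for n \<omega>
    using orthogonal_factors[OF M indep[OF that(1)] that(2)] by auto
  have inv: "invertible_mat (A n \<omega>)" if "n \<ge> 1" "\<omega> \<in> space M" for n \<omega>
    unfolding A by (rule minv_svd(1)[OF s[OF that(1)] s_pos[OF that(1)] RQ[OF that]])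
  have op: "0 \<le> op_norm 2 (minv (A n \<omega>))" "op_norm 2 (minv (A n \<omega>)) \<le> lp_norm \<infinity> (t n)"
    if "n \<ge> 1" "\<omega> \<in> space M" for n \<omega>
    using minv_svd(2)[OF s[OF that(1)] s_pos[OF that(1)] RQ[OF that]]
      op_norm_svd_inverse[OF s[OF that(1)] s_pos[OF that(1)] RQ[OF that]]
    unfolding A t_def by (simp_all only:)

  obtain C where C: "C > 0" "\<forall>\<^sub>F n in sequentially. \<bar>lp_norm \<infinity> (t n)\<bar> \<le> C * \<bar>real n powr \<gamma>\<bar>"
    using landau_o.bigE[OF assms(13)] unfolding t_def by auto
  have op_bound: "\<forall>\<^sub>F n in sequentially. \<forall>\<omega>\<in>space M. op_norm 2 (minv (A n \<omega>)) \<le> C * real n powr \<gamma>"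
    using C(2) eventually_ge_at_top[of 1]
  proof eventually_elim
    case (elim n)
    then show ?case using op(2)[of n] by fastforce
  qed

  obtain kb Kb where kb: "kb > 0" "Kb > 0" "\<forall>\<^sub>F n in sequentially. kb \<le> b n \<bullet> b n \<and> b n \<bullet> b n \<le> Kb"
    by (rule self_scalar_prod_bounded_of_lp_norms[OF assms(7,8)])
  obtain kc Kc where kc: "kc > 0" "Kc > 0" "\<forall>\<^sub>F n in sequentially. kc \<le> c n \<bullet> c n \<and> c n \<bullet> c n \<le> Kc"
    by (rule self_scalar_prod_bounded_of_lp_norms[OF assms(9,10)])
  obtain kt Kt where kt: "kt > 0" "Kt > 0"
    "\<forall>\<^sub>F n in sequentially. kt * \<bar>real n\<bar> \<le> \<bar>lp_norm 2 (t n)\<bar>"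
    "\<forall>\<^sub>F n in sequentially. \<bar>lp_norm 2 (t n)\<bar> \<le> Kt * \<bar>real n\<bar>"
    unfolding t_def by (rule eventually_bounds_of_bigtheta[OF assms(14)])
  have tt: "\<forall>\<^sub>F n in sequentially. kt\<^sup>2 * (real n)\<^sup>2 \<le> t n \<bullet> t n \<and> t n \<bullet> t n \<le> Kt\<^sup>2 * (real n)\<^sup>2"
    using kt(3,4)
  proof eventually_elim
    case (elim n)
    have "(kt * real n)\<^sup>2 \<le> (lp_norm 2 (t n))\<^sup>2" "(lp_norm 2 (t n))\<^sup>2 \<le> (Kt * real n)\<^sup>2"
      using elim kt(1,2) lp_norm_nonneg[of 2 "t n"] by (auto intro!: power_mono)
    then show ?case unfolding lp_norm_2_square by (simp add: power_mult_distrib)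
  qed

  note sens = expected_sensitivity[OF b c s s_pos M indep haar_R haar_Q, folded \<phi> t]
  note resp = expected_response[OF b c s s_pos M indep haar_R haar_Q, folded \<phi> t]

  have sens_omega: "(\<lambda>n. \<integral>\<omega>. sensitivity (c n) (\<phi> n \<omega>) \<partial>M) \<in> \<Omega>(\<lambda>n. real n)"
  proof (rule landau_omega.bigI)
    show "kc * kb * kt ^ 4 / 6 > 0" using kb kc kt by simp
    show "\<forall>\<^sub>F n in sequentially. norm (\<integral>\<omega>. sensitivity (c n) (\<phi> n \<omega>) \<partial>M)
        \<ge> kc * kb * kt ^ 4 / 6 * norm (real n)"
      using kb(3) kc(3) tt eventually_ge_at_top[of 2]
    proof eventually_elim
      case (elim n)
      \<comment> \<open>For \<open>n \<ge> 2\<close> the factor \<open>n + 2\<close> in the denominator is at most \<open>2 n\<close>.\<close>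
      have "kc * kb * kt ^ 4 / 6 * real n = kc * kb * (kt\<^sup>2 * (real n)\<^sup>2)\<^sup>2 / (3 * (real n)\<^sup>2 * (2 * real n))"
        using elim(4) by (simp add: field_simps power2_eq_square eval_nat_numeral)
      also have "\<dots> \<le> (c n \<bullet> c n) * (b n \<bullet> b n) * (t n \<bullet> t n)\<^sup>2 / (3 * (real n)\<^sup>2 * (real n + 2))"
        using elim kb(1) kc(1) by (intro frac_le mult_mono power_mono mult_nonneg_nonneg) auto
      also have "\<dots> \<le> (\<integral>\<omega>. sensitivity (c n) (\<phi> n \<omega>) \<partial>M)"
        using elim(4) by (intro sens(2)) auto
      finally show ?case by simp
    qed
  qed

  have resp_bigo: "(\<lambda>n. \<integral>\<omega>. \<bar>response (c n) (\<phi> n \<omega>)\<bar>\<^sup>2 \<partial>M) \<in> O(\<lambda>_. 1)"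
  proof (rule landau_o.bigI)
    show "Kc * Kb * Kt\<^sup>2 > 0" using kb kc kt by simp
    show "\<forall>\<^sub>F n in sequentially. norm (\<integral>\<omega>. \<bar>response (c n) (\<phi> n \<omega>)\<bar>\<^sup>2 \<partial>M)
        \<le> Kc * Kb * Kt\<^sup>2 * norm (1 :: real)"
      using kb(3) kc(3) tt eventually_ge_at_top[of 1]
    proof eventually_elim
      case (elim n)
      have "(c n \<bullet> c n) * (b n \<bullet> b n) * (t n \<bullet> t n) \<le> Kc * Kb * (Kt\<^sup>2 * (real n)\<^sup>2)"
        using elim kb(2) kc(2) by (intro mult_mono mult_nonneg_nonneg self_scalar_prod_nonneg) auto
      then have "(c n \<bullet> c n) * (b n \<bullet> b n) * (t n \<bullet> t n) / (real n)\<^sup>2 \<le> Kc * Kb * Kt\<^sup>2"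
        using elim(4) by (simp add: divide_le_eq mult.assoc)
      then show ?case
        using resp(2)[of n] elim(4) by (simp add: self_scalar_prod_nonneg)
    qed
  qed

  have A_to_E: "conditions_A_to_E L \<mu> \<gamma> f c (\<lambda>n. \<phi> n \<omega>)" if \<omega>: "\<omega> \<in> space M" for \<omega>
  proof -
    have fam: "is_design_family c (\<lambda>n. \<phi> n \<omega>)"
      unfolding is_design_family_def
    proof (intro allI impI conjI exI)
      fix n :: nat assume n: "n \<ge> 1"
      show "c n \<in> carrier_vec n" by (rule c[OF n])
      show "is_physical_system n n (\<phi> n \<omega>)"
        using RQ[OF n \<omega>, THEN orthogonal_mats_carrier] s[OF n] b[OF n]
        by (simp add: \<phi> is_physical_system_def diag_def mult_carrier_mat[of _ n n _ n])
    qed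
    have B: "cond_B \<gamma> (\<lambda>n. A n \<omega>)"
      unfolding cond_B_def
    proof (intro conjI allI impI)
      show "(\<lambda>n. op_norm 2 (minv (A n \<omega>))) \<in> O(\<lambda>n. real n powr \<gamma>)"
      proof (rule landau_o.bigI[OF C(1)])
        show "\<forall>\<^sub>F n in sequentially. norm (op_norm 2 (minv (A n \<omega>))) \<le> C * norm (real n powr \<gamma>)"
          using op_bound eventually_ge_at_top[of 1]
        proof eventually_elim
          case (elim n)
          then have "0 \<le> op_norm 2 (minv (A n \<omega>))" "op_norm 2 (minv (A n \<omega>)) \<le> C * real n powr \<gamma>"
            using op(1)[of n \<omega>] \<omega> by blast+
          then show ?case by simp
        qed
      qed
    qed (rule inv[OF _ \<omega>])
    have "cond_C (\<lambda>n. 1\<^sub>m n)"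
      unfolding cond_C_def
      using op_norm_one_bounds by (intro ballI landau_o.bigI[of 1]) auto
    moreover have "cond_DE b" "cond_DE c"
      using assms(7-10)[THEN bigthetaD1] by (auto simp: cond_DE_def)
    moreover have "cond_A L \<mu> f" using assms(1-3) by (simp add: cond_A_def)
    ultimately show ?thesis
      using fam B unfolding conditions_A_to_E_def by (simp add: \<phi> A)
  qed

  have "asymptotic_convergence_conditions_on_average M L \<mu> (1 - \<gamma>) \<gamma> f c \<phi>"
    unfolding asymptotic_convergence_conditions_on_average_def
  proof (intro conjI ballI allI impI)
    have "(\<lambda>n. real n powr (1 - \<gamma> + \<gamma>)) = (\<lambda>n. real n)" by simp
    then show "(\<lambda>n. \<integral>\<omega>. sensitivity (c n) (\<phi> n \<omega>) \<partial>M) \<in> \<Omega>(\<lambda>n. real n powr (1 - \<gamma> + \<gamma>))"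
      using sens_omega by simp
  qed (use A_to_E sens(1) resp(1) resp_bigo in blast)+
  moreover have "\<phi> n \<omega> = (A n \<omega>, B n, b n)" for n \<omega> by (rule assms(21))
  ultimately show ?thesis
    using inv op_bound C(1) sens_omega resp_bigo by (auto simp: sensitivity_def response_def)
qed

end
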